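(* For each integer $n \ge 1$, \[ h^*(\Sigma(\Gamma(n+1));t) = \sum_{\ell=0}^{\lfloor n/2 \rfloor}(2t)^{n-2\ell-1}\left( 2t\binom{n}{2\ell} + (1+t)^2\binom{n}{2\ell+1} \right) \sum_{(p,q) \in S_{2\ell}}\binom{2\ell+1}{p+q+1}f_{p,q,\ell}(t), \] where \[ S_k =\{(x,y) \in \mathbb{Z}^2 \mid x \geq 0,\ y \geq 0,\ x+y \leq k\} \] and \[ f_{p,q,\ell}(t) = t^{2\ell-p-q}\sum_{i=0}^p\sum_{j=0}^q\binom{p}{i}\binom{q}{j}\binom{2\ell-p-q}{\ell-q-i+j}t^{2(i+j)}. \]
   Context: For $n \ge 1$, $\Gamma(n+1)$ is the graph on the $2n+1$ vertices $u_1,v_1,u_2,v_2,\dots,u_n,v_n,u_{n+1}$ with edges $u_iu_{i+1}$, $u_iv_i$, $v_iu_{i+1}$ for $i=1,\dots,n$, together with the edge $u_1u_{n+1}$. (For $n=1$ the edge $u_1u_{n+1}$ is parallel to $u_1u_2$; this does not affect the polytope below.) For a graph $G=(V,E)$, the symmetric edge polytope is $\Sigma(G) = \operatorname{conv}\{\pm(e_i - e_j) \in \mathbb{R}^V \mid ij \in E\}$, where $e_i$ are the standard basis vectors. For a lattice polytope $P \subset \mathbb{R}^N$, let $L_P(m) = |mP \cap \mathbb{Z}^N|$ for $m\ge1$ and $L_P(0)=1$; the $h^*$-polynomial $h^*(P;t)$ is defined by $\sum_{m \ge 0} L_P(m) t^m = h^*(P;t)/(1-t)^{\dim P + 1}$.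 Convention: $\binom{a}{b} = 0$ for integers $a\ge 0$ and $b<0$ or $b>a$. When $n=2\ell$ the factor $(2t)^{n-2\ell-1}=(2t)^{-1}$ is multiplied by $2t\binom{n}{n}+(1+t)^2\binom{n}{n+1}=2t$, so each summand is a polynomial. *)

theory Defs
  imports
    "HOL-Analysis.Analysis"
    "HOL-Computational_Algebra.Computational_Algebra"
begin

section \<open>Symmetric edge polytopes and the graphs $\Gamma(n+1)$\<close>

text \<open>
  A graph with vertex set the finite type \<open>'v\<close> is given by its set of edges, each edge being a
  two-element set of vertices; \<open>\<real>\<^sup>V\<close> is then \<open>real ^ 'v\<close> and \<open>e\<^sub>i\<close> is \<open>axis i 1\<close>.
\<close>

definition sym_edge_polytope :: "'v::finite set set \<Rightarrow> (real ^ 'v) set" where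
  "sym_edge_polytope E = convex hull
     (\<Union>{{axis i 1 - axis j 1, - (axis i 1 - axis j 1)} | i j. {i, j} \<in> E})"

text \<open>
  The vertex set of $\Gamma(n+1)$ has $2n+1$ elements, so it is presented as a finite type whose
  elements are listed, without repetition, as $u_1, \dots, u_{n+1}, v_1, \dots, v_n$.
  Values of \<open>u\<close> and \<open>v\<close> at other indices play no role.
\<close>

definition Gamma_vertices :: "nat \<Rightarrow> (nat \<Rightarrow> 'v) \<Rightarrow> (nat \<Rightarrow> 'v) \<Rightarrow> bool" where
  "Gamma_vertices n u v \<longleftrightarrow>
     inj_on u {1..n+1} \<and> inj_on v {1..n} \<and>
     u ` {1..n+1} \<inter> v ` {1..n} = {} \<and> u ` {1..n+1} \<union> v ` {1..n} = UNIV"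

text \<open>For \<open>n = 1\<close> the parallel edges $u_1u_2$ and $u_1u_{n+1}$ coincide in this set.\<close>

definition Gamma_edges :: "nat \<Rightarrow> (nat \<Rightarrow> 'v) \<Rightarrow> (nat \<Rightarrow> 'v) \<Rightarrow> 'v set set" where
  "Gamma_edges n u v =
     (\<Union>i\<in>{1..n}. {{u i, u (i+1)}, {u i, v i}, {v i, u (i+1)}}) \<union> {{u 1, u (n+1)}}"

text \<open>Every type with $2n+1$ elements can serve as the vertex set.\<close>

lemma Gamma_vertices_exists:
  assumes "CARD('v::finite) = 2 * n + 1"
  shows "\<exists>u v :: nat \<Rightarrow> 'v. Gamma_vertices n u v"
proof -
  obtain h :: "nat \<Rightarrow> 'v" where h: "bij_betw h {0..<2*n+1} UNIV"
    using ex_bij_betw_nat_finite[of "UNIV :: 'v set"] assms by auto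
  let ?g = "\<lambda>i::nat. i - 1" and ?k = "\<lambda>i::nat. n + i"
  have inj: "inj_on h {0..<2*n+1}" and img: "h ` {0..<2*n+1} = UNIV"
    using h by (auto simp: bij_betw_def)
  have gi: "?g ` {1..n+1} = {0..<n+1}"
  proof
    show "{0..<n+1} \<subseteq> ?g ` {1..n+1}"
      by (auto intro!: image_eqI[where x = "Suc _"])
  qed auto
  have ki: "?k ` {1..n} = {n+1..<2*n+1}"
  proof
    show "{n+1..<2*n+1} \<subseteq> ?k ` {1..n}"
      by (auto intro!: image_eqI[where x = "_ - n"])
  qed auto
  have "inj_on (h \<circ> ?g) {1..n+1}"
    by (intro comp_inj_on inj_on_subset[OF inj] inj_onI) auto
  moreover have "inj_on (h \<circ> ?k) {1..n}"
    by (intro comp_inj_on inj_on_subset[OF inj] inj_onI) auto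
  moreover have "h ` {0..<n+1} \<inter> h ` {n+1..<2*n+1} = {}"
    by (subst inj_on_image_Int[OF inj, symmetric]) auto
  moreover have "h ` {0..<n+1} \<union> h ` {n+1..<2*n+1} = UNIV"
    unfolding image_Un[symmetric] img[symmetric] by (rule arg_cong[of _ _ "image h"]) auto
  ultimately have "Gamma_vertices n (h \<circ> ?g) (h \<circ> ?k)"
    unfolding Gamma_vertices_def image_comp[symmetric] gi ki by simp
  then show ?thesis by blast
qed

section \<open>The $h^*$-polynomial\<close>

definition lattice_count :: "(real ^ 'v::finite) set \<Rightarrow> nat \<Rightarrow> nat" where
  "lattice_count P m =
     (if m = 0 then 1 else card {x \<in> (\<lambda>y. real m *\<^sub>R y) ` P. \<forall>i. x $ i \<in> \<int>})"

text \<open>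
  The defining identity is multiplied out in the ring of formal power series. The existence of
  such a polynomial for a lattice polytope is Ehrhart's theorem, uniqueness is clear.
\<close>

definition hstar :: "(real ^ 'v::finite) set \<Rightarrow> int poly" where
  "hstar P = (THE h. fps_of_poly h =
     Abs_fps (\<lambda>m. int (lattice_count P m)) * (1 - fps_X) ^ nat (aff_dim P + 1))"

lemma hstar_eqI:
  assumes "fps_of_poly h =
    Abs_fps (\<lambda>m. int (lattice_count P m)) * (1 - fps_X) ^ nat (aff_dim P + 1)"
  shows "hstar P = h"
  unfolding hstar_def using assms by (intro the_equality) (auto simp flip: fps_of_poly_eq_iff)

section \<open>The right-hand side\<close>

text \<open>The polynomial variable $t$.\<close>

abbreviation tX :: "int poly" where
  "tX \<equiv> [:0, 1:]"

text \<open>Binomial coefficients whose lower argument is an integer; zero if it is negative.\<close>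

definition binom :: "nat \<Rightarrow> int \<Rightarrow> nat" where
  "binom a b = (if b < 0 then 0 else a choose nat b)"

definition S_set :: "nat \<Rightarrow> (nat \<times> nat) set" where
  "S_set k = {(x, y). x + y \<le> k}"

text \<open>Only used for \<open>p + q \<le> 2 * l\<close>, so that the natural-number subtractions are exact.\<close>

definition f_poly :: "nat \<Rightarrow> nat \<Rightarrow> nat \<Rightarrow> int poly" where
  "f_poly p q l = tX ^ (2*l - p - q) *
     (\<Sum>i=0..p. \<Sum>j=0..q.
        of_nat ((p choose i) * (q choose j) * binom (2*l - p - q) (int l - int q - int i + int j))
        * tX ^ (2 * (i + j)))"

text \<open>
  The factor $(2t)^{n-2l-1}\bigl(2t\binom{n}{2l} + (1+t)^2\binom{n}{2l+1}\bigr)$ for \<open>2 * l \<le> n\<close>.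
  The exponent is $-1$ if \<open>n = 2 * l\<close>, so the factor is written as an exact division by $2t$;
  the two lemmas give its value in the two cases.
\<close>

definition outer_factor :: "nat \<Rightarrow> nat \<Rightarrow> int poly" where
  "outer_factor n l =
     ((2 * tX) ^ (n - 2*l) *
       (2 * tX * of_nat (n choose (2*l)) + (1 + tX)^2 * of_nat (n choose (2*l + 1)))) div (2 * tX)"

lemma two_tX_nonzero: "2 * tX \<noteq> 0"
  by (simp add: numeral_poly)

lemma outer_factor_less:
  assumes "2 * l < n"
  shows "outer_factor n l = (2 * tX) ^ (n - 2*l - 1) *
    (2 * tX * of_nat (n choose (2*l)) + (1 + tX)^2 * of_nat (n choose (2*l + 1)))"
proof -
  have "n - 2*l = Suc (n - 2*l - 1)" using assms by simp
  then have "(2 * tX) ^ (n - 2*l) = 2 * tX * (2 * tX) ^ (n - 2*l - 1)"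
    by (metis power_Suc)
  then show ?thesis
    unfolding outer_factor_def
    by (simp only: mult.assoc[of "2 * tX"] nonzero_mult_div_cancel_left[OF two_tX_nonzero])
qed

lemma outer_factor_eq: "outer_factor (2 * l) l = 1"
proof -
  have "outer_factor (2 * l) l = (2 * tX) div (2 * tX)"
    unfolding outer_factor_def by (simp add: binomial_eq_0)
  then show ?thesis
    by (simp only: div_self[OF two_tX_nonzero])
qed

end

theory Submission
  imports Defs
begin

text \<open>
  The incidence matrix of a graph is totally unimodular, so a lattice point of \<open>m \<Sigma>(G)\<close> is the
  divergence of an integral flow of cost at most \<open>m\<close>. For $\Gamma(n+1)$ a lattice point is
  given by pairs $(b_i, y_i)$, one for each triangle: $b_i$ is the value at $v_i$ and $y_i$ is
  the flow through the triangle, the latter up to a common circulation \<open>s\<close> along the long cycle.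
  The optimal cost inside a triangle is the length \<open>rho\<close> of the range of the three numbers
  $0, -b_i, y_i - s$, so the total cost is a convex function of \<open>s\<close>. Counting the points whose
  minimal cost is at most \<open>m\<close> amounts to counting the pairs of a point and the last \<open>s\<close> of cost
  at most \<open>m\<close>; after translating \<open>s\<close> to \<open>0\<close> the triangles become independent. Marking costs by
  \<open>t\<close> and increments at \<open>0\<close> by \<open>x\<close>, this yields, with $\sigma$ the total increment,
  $$h^* = \sum_{\sigma \ge 1} (1 + t + \dots + t^{\sigma-1})\,
    [x^\sigma]\, (x + t/x)\,\bigl((1+t)(x + t/x) + 2t\bigr)^n.$$
  Expanding by the binomial theorem gives the outer sum of the right-hand side, and its inner sum
  is evaluated as a coefficient of a geometric sum:
  $f_{p,q,l} = [y^l]\, a^p b^q c^{2l-p-q}$ with $a = 1 + t^2 y$, $b = y + t^2$, $c = t(1+y)$.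
\<close>

section \<open>The inner sum\<close>

lemma coeff_one_plus_X_power:
  "coeff ([:1, c:] ^ n) k = of_nat (n choose k) * (c::'a::comm_ring_1) ^ k"
proof -
  have "[:1, c:] ^ n = (monom c 1 + 1) ^ n" by (simp add: monom_altdef one_pCons)
  also have "\<dots> = (\<Sum>i\<le>n. monom (of_nat (n choose i) * c ^ i) i)"
    by (simp add: binomial_ring monom_power of_nat_poly smult_monom)
  finally show ?thesis by (simp add: coeff_sum binomial_eq_0)
qed

lemma coeff_X_plus_const_power:
  assumes "k \<le> n"
  shows "coeff ([:c, 1:] ^ n) k = of_nat (n choose k) * (c::'a::comm_ring_1) ^ (n - k)"
proof -
  have "[:c, 1:] ^ n = ([:0, 1:] + [:c:]) ^ n" by simp
  also have "\<dots> = (\<Sum>i\<le>n. monom (of_nat (n choose i) * c ^ (n - i)) i)"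
    unfolding binomial_ring
    by (intro sum.cong) (simp_all add: monom_altdef of_nat_poly poly_const_pow mult.assoc mult.commute)
  finally show ?thesis using assms by (simp add: coeff_sum)
qed

text \<open>Multiplication by 1 - y takes differences of consecutive coefficients, and these
  telescope; dividing by 1 - y thus means summing coefficients.\<close>

lemma coeff_eq_sum_coeff_mult_one_minus_X:
  "coeff p n = (\<Sum>j\<le>n. coeff (p * [:1, - 1:]) j)" for p :: "'a::comm_ring_1 poly"
  by (induction n) (simp_all add: coeff_pCons)

lemma sum_S_set:
  "(\<Sum>(p, q)\<in>S_set k. h p q) = (\<Sum>s\<le>k. \<Sum>p\<le>s. h p (s - p))"
proof -
  have "(\<Sum>s\<le>k. \<Sum>p\<le>s. h p (s - p)) = (\<Sum>(s, p)\<in>(SIGMA s:{..k}. {..s}). h p (s - p))"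
    by (simp add: sum.Sigma)
  also have "\<dots> = (\<Sum>(p, q)\<in>S_set k. h p q)"
    by (rule sum.reindex_bij_witness[of _ "\<lambda>(p, q). (p + q, p)" "\<lambda>(s, p). (p, s - p)"])
      (auto simp: S_set_def)
  finally show ?thesis by simp
qed

text \<open>Along a diagonal p + q = s the factor a - b turns the geometric sum into a^(s+1) -
  b^(s+1). What remains are two binomial expansions whose common term c^(k+1) cancels.\<close>

lemma S_set_trinomial_sum:
  fixes a b c :: "'a::comm_ring_1"
  shows "(a - b) * (\<Sum>(p, q)\<in>S_set k.
      of_nat (Suc k choose (p + q + 1)) * (a ^ p * b ^ q * c ^ (k - p - q)))
    = (a + c) ^ Suc k - (b + c) ^ Suc k"
proof -
  have pw: "(d + c) ^ Suc k = c ^ Suc k +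
      (\<Sum>s\<le>k. of_nat (Suc k choose Suc s) * (d ^ Suc s * c ^ (k - s)))" for d
    unfolding binomial_ring[of d c "Suc k"] by (simp only: sum.atMost_Suc_shift) (simp add: mult.assoc)
  have "(a - b) * (\<Sum>(p, q)\<in>S_set k.
      of_nat (Suc k choose (p + q + 1)) * (a ^ p * b ^ q * c ^ (k - p - q)))
    = (\<Sum>s\<le>k. of_nat (Suc k choose Suc s) * c ^ (k - s) *
        ((a - b) * (\<Sum>p<Suc s. a ^ p * b ^ (s - p))))"
    unfolding sum_S_set sum_distrib_left lessThan_Suc_atMost
    by (intro sum.cong refl) (simp add: algebra_simps)
  also have "\<dots> = (\<Sum>s\<le>k. of_nat (Suc k choose Suc s) * c ^ (k - s) * (a ^ Suc s - b ^ Suc s))"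
    by (simp only: diff_power_eq_sum[symmetric])
  also have "\<dots> = (a + c) ^ Suc k - (b + c) ^ Suc k"
    unfolding pw by (simp only: sum_subtractf[symmetric] add_diff_cancel_left) (simp add: algebra_simps)
  finally show ?thesis .
qed

text \<open>Let y be the variable of the outer polynomial. The index i belongs to y^i in the first
  power and j to y^(q-j) in the second, so the third power has to supply y^(l-q-i+j).\<close>

lemma f_poly_eq_coeff:
  assumes "p + q \<le> 2 * l"
  shows "f_poly p q l =
    coeff ([:1, tX ^ 2:] ^ p * [:tX ^ 2, 1:] ^ q * [:tX, tX:] ^ (2*l - p - q)) l"
proof -
  define r where "r = 2*l - p - q"
  have P: "[:1, tX ^ 2:] ^ p = (\<Sum>i\<le>p. monom (of_nat (p choose i) * tX ^ (2 * i)) i)"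
    by (rule poly_eqI) (simp add: coeff_one_plus_X_power coeff_sum power_mult binomial_eq_0)
  have "[:tX ^ 2, 1:] ^ q = ([:tX ^ 2:] + [:0, 1:]) ^ q" by simp
  also have "\<dots> = (\<Sum>j\<le>q. monom (of_nat (q choose j) * tX ^ (2 * j)) (q - j))"
    unfolding binomial_ring
    by (intro sum.cong) (simp_all add: monom_altdef of_nat_poly poly_const_pow mult.assoc mult.commute flip: power_mult)
  finally have Q: "[:tX ^ 2, 1:] ^ q = \<dots>" .
  have "[:tX, tX:] = [:tX:] * [:1, 1:]" by simp
  then have R: "[:tX, tX:] ^ r = [:tX ^ r:] * [:1, 1:] ^ r"
    by (simp only: power_mult_distrib poly_const_pow)
  \<comment> \<open>If i + (q - j) > l, the lower argument of \<open>binom\<close> is negative and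
    both sides vanish.\<close>
  have cf: "coeff (monom a i * monom b (q - j) * ([:d:] * [:1, 1:] ^ r)) l =
      d * (of_nat (binom r (int l - int q - int i + int j)) * (a * b))"
    if "j \<le> q" for a b d :: "int poly" and i j
  proof -
    have "nat (int l - int q - int i + int j) = l - (i + (q - j))"
      using that by simp
    then show ?thesis using that
      by (simp add: mult_monom coeff_monom_mult coeff_one_plus_X_power[of 1, simplified] binom_def)
        (auto simp: mult_ac)
  qed
  show ?thesis
    unfolding f_poly_def r_def[symmetric] P Q R
    unfolding sum_product
    unfolding sum_distrib_right coeff_sum atLeast0AtMost
      sum_distrib_left mult.assoc[of "monom _ _ * monom _ _"]
    by (intro sum.cong refl) (subst cf, simp, simp add: power_add distrib_left mult_ac)
qed

section \<open>Reduction of the right-hand side to half sums of binomials\<close>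

lemma one_minus_square: "1 - x ^ 2 = (1 + x) * (1 - x)" for x :: "'a::comm_ring_1"
  by (simp add: algebra_simps power2_eq_square)

text \<open>The j-th term comes from x^(N-2j) in (x + t/x)^N, weighted by 1 - t^(N-2j); the
  condition on j selects the positive exponents of x.\<close>

definition half_sum :: "nat \<Rightarrow> int poly" where
  "half_sum N = (\<Sum>j | 2 * j < N. of_nat (N choose j) * (tX ^ j - tX ^ (N - j)))"

text \<open>The trinomial sum factors well: a - b = (1 - t^2)(1 - y), a + c = (1 + t)(1 + t y) and b
  + c = (1 + t)(t + y). Dividing by 1 - y makes the coefficient of y^l a sum over all j \<le> l,
  that is, over the lower half of 0..2l+1. One factor 1 + t cancels.\<close>

lemma sum_f_poly:
  "(1 - tX) * (\<Sum>(p, q)\<in>S_set (2*l). of_nat ((2*l + 1) choose (p + q + 1)) * f_poly p q l)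
    = (1 + tX) ^ (2 * l) * half_sum (2 * l + 1)"
proof -
  define a b c :: "int poly poly" where "a = [:1, tX ^ 2:]" and "b = [:tX ^ 2, 1:]" and "c = [:tX, tX:]"
  define P where "P = (\<Sum>(p, q)\<in>S_set (2*l).
      of_nat (Suc (2*l) choose (p + q + 1)) * (a ^ p * b ^ q * c ^ (2*l - p - q)))"
  define D where "D = (\<Sum>(p, q)\<in>S_set (2*l). of_nat ((2*l + 1) choose (p + q + 1)) * f_poly p q l)"
  have D: "coeff P l = D"
    unfolding P_def D_def coeff_sum
    by (intro sum.cong refl)
      (auto simp: S_set_def f_poly_eq_coeff a_def b_def c_def of_nat_poly simp del: of_nat_add)
  have ab: "a - b = [:1 - tX ^ 2:] * [:1, - 1:]"
    by (simp add: a_def b_def)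
  have ac: "a + c = [:1 + tX:] * [:1, tX:]"
    by (simp add: a_def c_def algebra_simps power2_eq_square)
  have bc: "b + c = [:1 + tX:] * [:tX, 1:]"
    by (simp add: b_def c_def algebra_simps power2_eq_square)
  have eq: "[:1 - tX ^ 2:] * (P * [:1, - 1:]) =
      [:(1 + tX) ^ Suc (2*l):] * ([:1, tX:] ^ Suc (2*l) - [:tX, 1:] ^ Suc (2*l))"
  proof -
    have "(a - b) * P = (a + c) ^ Suc (2*l) - (b + c) ^ Suc (2*l)"
      unfolding P_def by (rule S_set_trinomial_sum)
    then show ?thesis
      unfolding ab ac bc power_mult_distrib poly_const_pow right_diff_distrib
      by (simp only: mult_ac)
  qed
  have "(1 - tX ^ 2) * D = (\<Sum>j\<le>l. coeff ([:1 - tX ^ 2:] * (P * [:1, - 1:])) j)"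
    unfolding D[symmetric] coeff_eq_sum_coeff_mult_one_minus_X[of P] by (simp add: sum_distrib_left)
  also have "\<dots> = (\<Sum>j\<le>l. (1 + tX) ^ Suc (2*l) * (of_nat (Suc (2*l) choose j) * (tX ^ j - tX ^ (Suc (2*l) - j))))"
    unfolding eq
    by (intro sum.cong refl)
      (simp add: coeff_one_plus_X_power coeff_X_plus_const_power right_diff_distrib del: power_Suc)
  also have "\<dots> = (1 + tX) ^ Suc (2*l) * half_sum (2*l + 1)"
  proof -
    have "{j. 2 * j < 2 * l + 1} = {..l}" by auto
    then show ?thesis unfolding half_sum_def sum_distrib_left by simp
  qed
  finally have "(1 + tX) * ((1 - tX) * D) = (1 + tX) * ((1 + tX) ^ (2*l) * half_sum (2*l + 1))"
    by (simp only: one_minus_square[of tX] power_Suc mult_ac)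
  moreover have "1 + tX \<noteq> 0" by (simp add: one_pCons)
  ultimately show ?thesis unfolding D_def by (simp only: mult_cancel_left) simp
qed

text \<open>Pascal's rule gives the identity up to differences of \<open>F\<close>, which telescope
  to the boundary term at l. It vanishes since both of its exponents are l + 1.\<close>

lemma half_sum_even: "half_sum (2 * l + 2) = (1 + tX) * half_sum (2 * l + 1)"
proof -
  let ?N = "2 * l + 1"
  have s1: "{j. 2 * j < 2 * l + 2} = {..l}" and s2: "{j. 2 * j < 2 * l + 1} = {..l}" by auto
  define F where "F j = of_nat (?N choose j) * (tX ^ Suc j - tX ^ (?N - j))" for j
  have step: "(of_nat (Suc ?N choose j) :: int poly) * (tX ^ j - tX ^ (Suc ?N - j)) =
     (1 + tX) * (of_nat (?N choose j) * (tX ^ j - tX ^ (?N - j)))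
     + (case j of 0 \<Rightarrow> 0 | Suc i \<Rightarrow> F i) - F j" if "j \<le> l" for j
  proof (cases j)
    case 0
    then show ?thesis by (simp add: F_def algebra_simps)
  next
    case (Suc i)
    then have "?N - i = Suc (?N - j)" "Suc ?N - j = Suc (?N - j)" using that by auto
    with Suc show ?thesis unfolding F_def by (simp del: power_Suc add: power_Suc[of _ "?N - Suc i"] algebra_simps)
       (simp add: algebra_simps)
  qed
  have "(\<Sum>j\<le>k. (case j of 0 \<Rightarrow> 0 | Suc i \<Rightarrow> F i) - F j) = - F k" for k
    by (induction k) auto
  from this[of l] have tel: "(\<Sum>j\<le>l. (case j of 0 \<Rightarrow> 0 | Suc i \<Rightarrow> F i) - F j) = 0"
    by (simp add: F_def)
  have "half_sum (2 * l + 2) = (\<Sum>j\<le>l. (1 + tX) * (of_nat (?N choose j) * (tX ^ j - tX ^ (?N - j)))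
     + ((case j of 0 \<Rightarrow> 0 | Suc i \<Rightarrow> F i) - F j))"
    unfolding half_sum_def s1 using step by (intro sum.cong) (auto simp del: power_Suc binomial_Suc_Suc)
  also have "\<dots> = (1 + tX) * half_sum (2 * l + 1)"
    unfolding sum.distrib tel half_sum_def s2 by (simp add: sum_distrib_left)
  finally show ?thesis .
qed

text \<open>The common value to which 1 - t times either side of the theorem is reduced; k is the
  number of blocks from which the term (1 + t)(x + t/x) is chosen.\<close>

definition cyc_sum :: "nat \<Rightarrow> int poly" where
  "cyc_sum n = (\<Sum>k\<le>n. of_nat (n choose k) * (2 * tX) ^ (n - k) * (1 + tX) ^ k * half_sum (k + 1))"

text \<open>The terms k = 2l and k = 2l + 1 of \<open>cyc_sum\<close> are merged. By
  \<open>half_sum_even\<close> the odd one gains another factor 1 + t, which produces the square in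
  \<open>outer_factor\<close>.\<close>

lemma rhs_eq_cyc_sum:
  "(1 - tX) * (\<Sum>l=0..n div 2. outer_factor n l *
      (\<Sum>(p, q)\<in>S_set (2*l). of_nat ((2*l + 1) choose (p + q + 1)) * f_poly p q l)) = cyc_sum n"
proof -
  define D where "D l = (\<Sum>(p, q)\<in>S_set (2*l). of_nat ((2*l + 1) choose (p + q + 1)) * f_poly p q l)" for l
  define c where "c k = of_nat (n choose k) * (2 * tX) ^ (n - k) * (1 + tX) ^ k * half_sum (k + 1)" for k
  have step: "outer_factor n l * ((1 - tX) * D l) = c (2*l) + c (2*l + 1)" if "l \<le> n div 2" for l
  proof (cases "2 * l < n")
    case True
    then have "n - 2*l = Suc (n - 2*l - 1)" "n - (2*l + 1) = n - 2*l - 1" by auto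
    then have "c (2*l) + c (2*l + 1) = (of_nat (n choose (2*l)) * (2 * tX * (2 * tX) ^ (n - 2*l - 1)) * (1 + tX) ^ (2*l)
       + of_nat (n choose (2*l + 1)) * (2 * tX) ^ (n - 2*l - 1) * ((1 + tX) ^ (2*l) * (1 + tX)) * (1 + tX)) * half_sum (2*l + 1)"
      unfolding c_def using half_sum_even[of l] by (simp add: algebra_simps)
    then show ?thesis
      unfolding D_def sum_f_poly outer_factor_less[OF True] by (simp only: power2_eq_square) (simp only: algebra_simps)
  next
    case False
    with that have "n = 2 * l" by simp
    then show ?thesis
      using sum_f_poly[of l] by (simp add: c_def D_def outer_factor_eq binomial_eq_0)
  qed
  have dbl: "(\<Sum>l=0..m. c (2*l) + c (2*l + 1)) = (\<Sum>k\<le>2*m + 1. c k)" for m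
    by (induction m) (simp_all add: add_ac)
  have "(1 - tX) * (\<Sum>l=0..n div 2. outer_factor n l * D l)
      = (\<Sum>l=0..n div 2. outer_factor n l * ((1 - tX) * D l))"
    unfolding sum_distrib_left by (simp only: mult.left_commute)
  also have "\<dots> = (\<Sum>k\<le>2*(n div 2) + 1. c k)"
    unfolding dbl[symmetric] using step by (intro sum.cong) auto
  \<comment> \<open>For even n the additional term k = n + 1 carries the factor n choose n + 1,
    which is zero.\<close>
  also have "\<dots> = (\<Sum>k\<le>n. c k)"
    by (rule sum.mono_neutral_right) (auto simp: c_def binomial_eq_0)
  finally show ?thesis unfolding D_def c_def cyc_sum_def .
qed

section \<open>Generating functions in two variables\<close>

abbreviation T :: "int fps" where "T \<equiv> fps_X"
abbreviation Z :: "int fps fps" where "Z \<equiv> fps_X"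

section \<open>Weighted sums of coefficients\<close>

lemma fps_of_poly_of_nat: "fps_of_poly (of_nat k) = of_nat k"
  by (simp add: of_nat_poly fps_of_nat fps_of_poly_const)

lemma fps_of_poly_half_sum:
  "(\<Sum>j\<le>N. of_nat (N choose j) * (T ^ j * (1 - T ^ (N - 2 * j)))) = fps_of_poly (half_sum N)"
proof -
  have "(\<Sum>j\<le>N. of_nat (N choose j) * (T ^ j * (1 - T ^ (N - 2 * j))))
      = (\<Sum>j | 2 * j < N. of_nat (N choose j) * (T ^ j * (1 - T ^ (N - 2 * j))))"
    by (rule sum.mono_neutral_right) auto
  also have "\<dots> = (\<Sum>j | 2 * j < N. of_nat (N choose j) * (T ^ j - T ^ (N - j)))"
    by (intro sum.cong refl) (simp add: right_diff_distrib flip: power_add)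
  also have "\<dots> = fps_of_poly (half_sum N)"
    unfolding half_sum_def
    by (simp add: fps_of_poly_sum fps_of_poly_mult fps_of_poly_diff fps_of_poly_power fps_of_poly_pCons
        fps_of_poly_of_nat)
  finally show ?thesis .
qed

text \<open>Each of the n + 1 factors is multiplied by x, written \<open>Z\<close>, to clear
  negative powers; hence \<tau> = \<sigma> + n + 1. For \<sigma> \<le> 0 the truncated subtraction
  makes the weight 1 - T^0 = 0. Expanding the n-th power and then the powers of \<open>w\<close>
  gives \<open>cyc_sum\<close>.\<close>

lemma weighted_coeff_sum:
  "(\<Sum>\<tau>\<le>2*n + 2. (1 - T ^ (\<tau> - n - 1)) *
      fps_nth ((Z ^ 2 + fps_const T) * (fps_const (1 + T) * (Z ^ 2 + fps_const T) + fps_const (2 * T) * Z) ^ n) \<tau>)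
   = fps_of_poly (cyc_sum n)"
proof -
  define L where "L F = (\<Sum>\<tau>\<le>2*n + 2. (1 - T ^ (\<tau> - n - 1)) * fps_nth F \<tau>)" for F
  define w where "w = Z ^ 2 + fps_const T"
  define a where "a k = of_nat (n choose k) * ((2 * T) ^ (n - k) * (1 + T) ^ k)" for k
  have L_sum: "L (\<Sum>i\<in>I. F i) = (\<Sum>i\<in>I. L (F i))" for F :: "nat \<Rightarrow> int fps fps" and I
    unfolding L_def fps_sum_nth sum_distrib_left by (rule sum.swap)
  have L_monom: "L (fps_const d * Z ^ e) = d * (1 - T ^ (e - n - 1))" if "e \<le> 2*n + 2" for d e
  proof -
    have "L (fps_const d * Z ^ e) = (\<Sum>\<tau>\<le>2*n + 2. if \<tau> = e then d * (1 - T ^ (e - n - 1)) else 0)"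
      unfolding L_def by (intro sum.cong) (auto simp: fps_X_power_nth)
    then show ?thesis using that by (simp add: sum.delta)
  qed
  have monom_mult: "fps_const d * Z ^ i * (fps_const e * Z ^ j) = fps_const (d * e) * Z ^ (i + j)" for d e i j
    unfolding fps_const_mult[symmetric] power_add by (simp only: mult_ac)
  have w_pow: "w ^ N = (\<Sum>j\<le>N. fps_const (of_nat (N choose j) * T ^ j) * Z ^ (2 * (N - j)))" for N
    unfolding w_def add.commute[of "Z ^ 2"] binomial_ring fps_const_mult[symmetric] fps_const_power[symmetric]
      fps_of_nat power_mult by (rule refl)
  have "w * (fps_const (1 + T) * w + fps_const (2 * T) * Z) ^ n
     = (\<Sum>k\<le>n. fps_const (a k) * Z ^ (n - k) * w ^ Suc k)"
    unfolding binomial_ring[of "fps_const (1 + T) * w"] sum_distrib_left a_def power_mult_distrib fps_const_power[symmetric]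
      fps_of_nat fps_const_mult[symmetric] power_Suc
    by (intro sum.cong refl) (simp only: mult_ac)
  also have "\<dots> = (\<Sum>k\<le>n. \<Sum>j\<le>k + 1. fps_const (a k * (of_nat ((k + 1) choose j) * T ^ j)) * Z ^ (n - k + 2 * (k + 1 - j)))"
    unfolding w_pow sum_distrib_left
    by (intro sum.cong) (simp_all only: monom_mult Suc_eq_plus1)
  finally have "L (w * (fps_const (1 + T) * w + fps_const (2 * T) * Z) ^ n) =
      (\<Sum>k\<le>n. \<Sum>j\<le>k + 1. a k * (of_nat ((k + 1) choose j) * T ^ j) * (1 - T ^ (n - k + 2 * (k + 1 - j) - n - 1)))"
    by (simp only: L_sum) (intro sum.cong refl L_monom, simp)
  also have "\<dots> = (\<Sum>k\<le>n. a k * (\<Sum>j\<le>k + 1. of_nat ((k + 1) choose j) * (T ^ j * (1 - T ^ (k + 1 - 2 * j)))))"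
    unfolding sum_distrib_left
  proof (intro sum.cong refl)
    fix k j assume "k \<in> {..n}" "j \<in> {..k + 1}"
    \<comment> \<open>Both sides are the exponent of x in the j-th term of (x + t/x)^(k+1),
      truncated at 0.\<close>
    then have "n - k + 2 * (k + 1 - j) - n - 1 = k + 1 - 2 * j" by auto
    then show "a k * (of_nat (k + 1 choose j) * T ^ j) * (1 - T ^ (n - k + 2 * (k + 1 - j) - n - 1)) =
           a k * (of_nat (k + 1 choose j) * (T ^ j * (1 - T ^ (k + 1 - 2 * j))))"
      by (simp only: mult_ac)
  qed
  also have "\<dots> = fps_of_poly (cyc_sum n)"
    unfolding fps_of_poly_half_sum cyc_sum_def a_def
    by (simp add: fps_of_poly_sum fps_of_poly_mult fps_of_poly_add fps_of_poly_power fps_of_poly_pCons fps_of_poly_of_nat mult.assoc)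
  finally show ?thesis unfolding L_def w_def .
qed

section \<open>Two-variable counting series, \<open>Z\<close> marking the first statistic and
  \<open>T\<close> the second\<close>

definition gf2 :: "'a set \<Rightarrow> ('a \<Rightarrow> nat) \<Rightarrow> ('a \<Rightarrow> nat) \<Rightarrow> int fps fps" where
  "gf2 S s c = Abs_fps (\<lambda>i. Abs_fps (\<lambda>k. int (card {a \<in> S. s a = i \<and> c a = k})))"

lemma gf2_nth: "fps_nth (fps_nth (gf2 S s c) i) k = int (card {a \<in> S. s a = i \<and> c a = k})"
  by (simp add: gf2_def)

lemma gf2_image:
  assumes "inj_on h S"
  shows "gf2 (h ` S) s c = gf2 S (s \<circ> h) (c \<circ> h)"
proof -
  have "card {a \<in> h ` S. s a = i \<and> c a = k} = card {a \<in> S. s (h a) = i \<and> c (h a) = k}" for i k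
  proof -
    have "{a \<in> h ` S. s a = i \<and> c a = k} = h ` {a \<in> S. s (h a) = i \<and> c (h a) = k}" by auto
    then show ?thesis using assms by (simp add: card_image inj_on_subset)
  qed
  then show ?thesis by (simp add: gf2_def)
qed

text \<open>The fibres over a pair of sums split into products of fibres, as in a Cauchy product.
  Finite sublevel sets of the costs make every fibre finite, so that cardinalities add up.\<close>

lemma gf2_Times:
  assumes "\<And>k. finite {a \<in> A. c a \<le> k}" and "\<And>k. finite {b \<in> B. d b \<le> k}"
  shows "gf2 (A \<times> B) (\<lambda>(a, b). s a + r b) (\<lambda>(a, b). c a + d b) = gf2 A s c * gf2 B r d"
proof (intro fps_ext)
  fix i k
  let ?A = "\<lambda>i k. {a \<in> A. s a = i \<and> c a = k}" and ?B = "\<lambda>i k. {b \<in> B. r b = i \<and> d b = k}"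
  have fin: "finite (?A i k)" "finite (?B i k)" for i k
    by (auto intro: finite_subset[OF _ assms(1)[of k]] finite_subset[OF _ assms(2)[of k]])
  have "{x \<in> A \<times> B. (case x of (a, b) \<Rightarrow> s a + r b) = i \<and> (case x of (a, b) \<Rightarrow> c a + d b) = k}
    = (\<Union>(i', k')\<in>{0..i} \<times> {0..k}. ?A i' k' \<times> ?B (i - i') (k - k'))"
    by auto
  then have "card {x \<in> A \<times> B. (case x of (a, b) \<Rightarrow> s a + r b) = i \<and> (case x of (a, b) \<Rightarrow> c a + d b) = k}
    = card (\<Union>(i', k')\<in>{0..i} \<times> {0..k}. ?A i' k' \<times> ?B (i - i') (k - k'))"
    by simp
  also have "\<dots> = (\<Sum>(i', k')\<in>{0..i} \<times> {0..k}. card (?A i' k' \<times> ?B (i - i') (k - k')))"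
    by (subst card_UN_disjoint) (auto simp: fin case_prod_unfold)
  also have "\<dots> = (\<Sum>i'=0..i. \<Sum>k'=0..k. card (?A i' k') * card (?B (i - i') (k - k')))"
    by (simp add: card_cartesian_product sum.cartesian_product)
  finally show "fps_nth (fps_nth (gf2 (A \<times> B) (\<lambda>(a, b). s a + r b) (\<lambda>(a, b). c a + d b)) i) k
      = fps_nth (fps_nth (gf2 A s c * gf2 B r d) i) k"
    by (simp add: gf2_nth fps_mult_nth fps_sum_nth)
qed

lemma finite_lists_sum_le:
  fixes c :: "'a \<Rightarrow> nat"
  assumes "\<And>k. finite {a. c a \<le> k}"
  shows "finite {zs. length zs = n \<and> (\<Sum>z\<leftarrow>zs. c z) \<le> k}"
proof (rule finite_subset)
  have aux: "c z \<le> k" if "(\<Sum>z\<leftarrow>zs. c z) \<le> k" "z \<in> set zs" for z zs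
    using that member_le_sum_list[of "c z" "map c zs"] by simp
  show "{zs. length zs = n \<and> (\<Sum>z\<leftarrow>zs. c z) \<le> k} \<subseteq> {zs. set zs \<subseteq> {a. c a \<le> k} \<and> length zs = n}"
    using aux by auto
  show "finite {zs. set zs \<subseteq> {a. c a \<le> k} \<and> length zs = n}"
    using assms by (rule finite_lists_length_eq)
qed

lemma gf2_lists:
  fixes c :: "'a \<Rightarrow> nat"
  assumes "\<And>k. finite {a. c a \<le> k}"
  shows "gf2 {zs. length zs = n} (\<lambda>zs. \<Sum>z\<leftarrow>zs. s z) (\<lambda>zs. \<Sum>z\<leftarrow>zs. c z) = gf2 UNIV s c ^ n"
proof (induction n)
  case 0
  have "{a. length a = 0 \<and> (\<Sum>z\<leftarrow>a. s z) = i \<and> (\<Sum>z\<leftarrow>a. c z) = k} = (if i = 0 \<and> k = 0 then {[]} else {})" for i k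
    by auto
  then show ?case
    by (intro fps_ext) (simp add: gf2_nth)
next
  case (Suc n)
  have eq: "{zs::'a list. length zs = Suc n} = (\<lambda>(z, zs). z # zs) ` (UNIV \<times> {zs. length zs = n})"
    by (auto simp: length_Suc_conv)
  have "gf2 {zs. length zs = Suc n} (\<lambda>zs. \<Sum>z\<leftarrow>zs. s z) (\<lambda>zs. \<Sum>z\<leftarrow>zs. c z) =
      gf2 (UNIV \<times> {zs. length zs = n}) (\<lambda>(z, zs). s z + (\<Sum>z\<leftarrow>zs. s z)) (\<lambda>(z, zs). c z + (\<Sum>z\<leftarrow>zs. c z))"
    unfolding eq by (subst gf2_image) (auto simp: inj_on_def comp_def case_prod_unfold)
  also have "\<dots> = gf2 UNIV s c * gf2 UNIV s c ^ n"
    unfolding Suc[symmetric]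
    by (rule gf2_Times) (use assms finite_lists_sum_le[OF assms, of n] in simp_all)
  finally show ?case by simp
qed

section \<open>Configurations and flow costs\<close>

text \<open>Polymorphic because integral and real flows are compared later. The pairs with value at
  most k form a hexagon.\<close>

definition rho :: "'a::linordered_idom \<Rightarrow> 'a \<Rightarrow> 'a" where
  "rho b y = max 0 (max (- b) y) - min 0 (min (- b) y)"

lemma rho_nonneg: "rho b y \<ge> 0"
  by (simp add: rho_def min_def max_def)

lemma rho_step:
  fixes b y :: int
  shows "rho b y - 1 \<le> rho b (y - 1)" "rho b (y - 1) \<le> rho b y + 1"
  by (auto simp: rho_def min_def max_def)

lemma rho_convex:
  fixes b y y' :: int
  assumes "y' \<le> y"
  shows "rho b (y - 1) - rho b y \<le> rho b (y' - 1) - rho b y'"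
  using assms by (auto simp: rho_def min_def max_def)

text \<open>Lowering y shortens the range exactly when y is the strict maximum of 0, -b, y. The
  alternatives say whether -b or 0 is the minimum.\<close>

lemma rho_slope_neg_iff:
  fixes b y k :: int
  shows "rho b y = k \<and> rho b (y - 1) = k - 1 \<longleftrightarrow>
    b = k - y \<and> 1 \<le> y \<and> y \<le> k \<or> y = k \<and> 1 - k \<le> b \<and> b \<le> - 1"
  unfolding rho_def min_def max_def by (auto split: if_splits)

text \<open>The range stays the same when 0 and -b are its ends and y - 1 still lies between them;
  the alternatives are the two signs of b.\<close>

lemma rho_slope_zero_iff:
  fixes b y k :: int
  shows "rho b y = k \<and> rho b (y - 1) = k \<longleftrightarrow>
    b = k \<and> 1 - k \<le> y \<and> y \<le> 0 \<or> b = - k \<and> 1 \<le> y \<and> y \<le> k"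
  unfolding rho_def min_def max_def by (auto split: if_splits)

text \<open>The range grows exactly when y is a minimum of the three numbers, ties included.\<close>

lemma rho_slope_pos_iff:
  fixes b y k :: int
  shows "rho b y = k \<and> rho b (y - 1) = k + 1 \<longleftrightarrow>
    y = - k \<and> 0 \<le> b \<and> b \<le> k \<or> b = - k - y \<and> 1 - k \<le> y \<and> y \<le> 0"
  unfolding rho_def min_def max_def by (auto split: if_splits)

text \<open>
  Increments from \<open>0\<close> to \<open>1\<close> are shifted by one for each item to make them natural numbers: a point
  with \<open>n\<close> blocks has total increment \<open>config_slope x - n - 1\<close>.
\<close>

definition point_cost :: "int \<Rightarrow> nat" where
  "point_cost p = nat \<bar>p\<bar>"

definition point_slope :: "int \<Rightarrow> nat" where
  "point_slope p = nat (\<bar>p - 1\<bar> - \<bar>p\<bar> + 1)"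

definition block_cost :: "int \<times> int \<Rightarrow> nat" where
  "block_cost = (\<lambda>(b, y). nat (rho b y))"

definition block_slope :: "int \<times> int \<Rightarrow> nat" where
  "block_slope = (\<lambda>(b, y). nat (rho b (y - 1) - rho b y + 1))"

section \<open>Counting series of points, blocks and configurations\<close>

lemma one_minus_X_geometric: "(1 - T) * Abs_fps (\<lambda>_. 1) = 1"
  by (rule fps_ext) (auto simp: left_diff_distrib fps_X_mult_nth)

lemma one_minus_X_sq_linear: "(1 - T) ^ 2 * Abs_fps int = T"
proof -
  have "(1 - T) * Abs_fps int = T * Abs_fps (\<lambda>_. 1)"
    by (rule fps_ext) (auto simp: left_diff_distrib fps_X_mult_nth)
  then have "(1 - T) ^ 2 * Abs_fps int = T * ((1 - T) * Abs_fps (\<lambda>_. 1))"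
    by (simp only: power2_eq_square mult.assoc) (simp only: mult.left_commute)
  then show ?thesis by (simp add: one_minus_X_geometric)
qed

text \<open>The increment is -1 for p \<ge> 1 and +1 for p \<le> 0, so the series is (T + Z^2)/(1 -
  T).\<close>

lemma gf2_point:
  "fps_const (1 - T) * gf2 UNIV point_slope point_cost = Z ^ 2 + fps_const T"
proof (rule fps_ext)
  fix i :: nat
  consider "i = 0" | "i = 2" | "i \<noteq> 0" "i \<noteq> 2" by blast
  then have "(1 - T) * fps_nth (gf2 UNIV point_slope point_cost) i = (if i = 0 then T else if i = 2 then 1 else 0)"
  proof cases
    case 1
    have "{p. point_slope p = 0 \<and> point_cost p = k} = (if k = 0 then {} else {int k})" for k
      by (auto simp: point_slope_def point_cost_def)
    then have "card {p. point_slope p = 0 \<and> point_cost p = k} = (if k = 0 then 0 else 1)" for k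
      by simp
    then have "fps_nth (gf2 UNIV point_slope point_cost) 0 = Abs_fps (\<lambda>_. 1) - 1"
      by (intro fps_ext) (simp add: gf2_nth)
    then show ?thesis using 1 one_minus_X_geometric by (simp add: right_diff_distrib)
  next
    case 2
    have "{p. point_slope p = 2 \<and> point_cost p = k} = {- int k}" for k
      by (auto simp: point_slope_def point_cost_def)
    then have "fps_nth (gf2 UNIV point_slope point_cost) 2 = Abs_fps (\<lambda>_. 1)"
      by (intro fps_ext) (simp add: gf2_nth)
    then show ?thesis using 2 one_minus_X_geometric by simp
  next
    case 3
    then have empty: "{p. point_slope p = i \<and> point_cost p = k} = {}" for k
      by (auto simp: point_slope_def point_cost_def abs_if split: if_splits)
    have "fps_nth (gf2 UNIV point_slope point_cost) i = 0"
      by (intro fps_ext) (simp add: gf2_nth empty)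
    then show ?thesis using 3 by simp
  qed
  then show "fps_nth (fps_const (1 - T) * gf2 UNIV point_slope point_cost) i = fps_nth (Z ^ 2 + fps_const T) i"
    by (simp add: fps_X_power_nth)
qed

lemma block_class_iff:
  "block_slope z = s \<and> block_cost z = k \<longleftrightarrow>
    z \<in> {(b, y). rho b y = int k \<and> rho b (y - 1) = int k + int s - 1}"
proof (cases z)
  case (Pair b y)
  then show ?thesis
    using rho_nonneg[of b y] rho_step(1)[of b y] by (auto simp: block_slope_def block_cost_def)
qed

text \<open>For k \<ge> 1 the counts 2k - 1, 2k and 2k + 1 of the three increments add up to the 6k
  lattice points on the boundary of the hexagon. For k = 0 truncated subtraction yields the correct
  count 0.\<close>

lemma card_block_slope_0:
  "card {z. block_slope z = 0 \<and> block_cost z = k} = 2 * k - 1"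
proof -
  have "{z. block_slope z = 0 \<and> block_cost z = k} = {(b, y). rho b y = int k \<and> rho b (y - 1) = int k - 1}"
    unfolding block_class_iff by auto
  also have "\<dots> = (\<lambda>y. (int k - y, y)) ` {1..int k} \<union> (\<lambda>b. (b, int k)) ` {1 - int k..- 1}"
    unfolding rho_slope_neg_iff by auto
  also have "card \<dots> = card {1..int k} + card {1 - int k..- 1}"
    by (subst card_Un_disjoint) (auto simp: card_image inj_on_def)
  finally show ?thesis by simp
qed

lemma card_block_slope_1:
  "card {z. block_slope z = 1 \<and> block_cost z = k} = 2 * k"
proof -
  have "{z. block_slope z = 1 \<and> block_cost z = k} = {(b, y). rho b y = int k \<and> rho b (y - 1) = int k}"
    unfolding block_class_iff by auto
  also have "\<dots> = (\<lambda>y. (int k, y)) ` {1 - int k..0} \<union> (\<lambda>y. (- int k, y)) ` {1..int k}"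
    unfolding rho_slope_zero_iff by auto
  also have "card \<dots> = card {1 - int k..0} + card {1..int k}"
    by (subst card_Un_disjoint) (auto simp: card_image inj_on_def)
  finally show ?thesis by simp
qed

lemma card_block_slope_2:
  "card {z. block_slope z = 2 \<and> block_cost z = k} = 2 * k + 1"
proof -
  have "{z. block_slope z = 2 \<and> block_cost z = k} = {(b, y). rho b y = int k \<and> rho b (y - 1) = int k + 1}"
    unfolding block_class_iff by auto
  also have "\<dots> = (\<lambda>b. (b, - int k)) ` {0..int k} \<union> (\<lambda>y. (- int k - y, y)) ` {1 - int k..0}"
    unfolding rho_slope_pos_iff by auto
  also have "card \<dots> = card {0..int k} + card {1 - int k..0}"
    by (subst card_Un_disjoint) (auto simp: card_image inj_on_def)
  finally show ?thesis by simp
qed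

lemma block_slope_le: "block_slope z \<le> 2"
  using rho_step(2) by (cases z) (auto simp: block_slope_def nat_le_iff algebra_simps)

lemma gf2_block:
  "fps_const ((1 - T) ^ 2) * gf2 UNIV block_slope block_cost
    = fps_const (1 + T) * (Z ^ 2 + fps_const T) + fps_const (2 * T) * Z"
proof (rule fps_ext)
  fix i :: nat
  define G :: "int fps" where "G = Abs_fps (\<lambda>_. 1)"
  have sqG: "(1 - T) ^ 2 * G = 1 - T"
    unfolding G_def power2_eq_square mult.assoc one_minus_X_geometric by simp
  consider "i = 0" | "i = 1" | "i = 2" | "i > 2" by linarith
  then have "(1 - T) ^ 2 * fps_nth (gf2 UNIV block_slope block_cost) i =
      (if i = 0 then (1 + T) * T else if i = 1 then 2 * T else if i = 2 then 1 + T else 0)"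
  proof cases
    case 1
    \<comment> \<open>The summand 1 corrects the constant term, where 2k - 1 would be -1 but the
      count is 0.\<close>
    have "fps_nth (gf2 UNIV block_slope block_cost) 0 = 2 * Abs_fps int - G + 1"
      by (rule fps_ext) (auto simp: gf2_nth card_block_slope_0 G_def fps_numeral_fps_const of_nat_diff)
    then have "(1 - T) ^ 2 * fps_nth (gf2 UNIV block_slope block_cost) 0 = 2 * T - (1 - T) + (1 - T) ^ 2"
      using one_minus_X_sq_linear sqG by (simp only: distrib_left right_diff_distrib mult.left_commute[of _ 2]) simp
    then show ?thesis using 1 by (simp add: power2_eq_square algebra_simps)
  next
    case 2
    have "fps_nth (gf2 UNIV block_slope block_cost) 1 = 2 * Abs_fps int"
      by (rule fps_ext) (simp add: gf2_nth card_block_slope_1[simplified] fps_numeral_fps_const)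
    then show ?thesis using 2 one_minus_X_sq_linear by (simp add: mult.left_commute[of _ 2])
  next
    case 3
    have "fps_nth (gf2 UNIV block_slope block_cost) 2 = 2 * Abs_fps int + G"
      by (rule fps_ext) (simp add: gf2_nth card_block_slope_2 G_def fps_numeral_fps_const)
    then show ?thesis using 3 one_minus_X_sq_linear sqG by (simp add: distrib_left mult.left_commute[of _ 2])
  next
    case 4
    then have empty: "{z. block_slope z = i \<and> block_cost z = k} = {}" for k
      using block_slope_le by (metis (mono_tags, lifting) Collect_empty_eq leD)
    have "fps_nth (gf2 UNIV block_slope block_cost) i = 0"
      by (intro fps_ext) (simp add: gf2_nth empty)
    then show ?thesis using 4 by simp
  qed
  then show "fps_nth (fps_const ((1 - T) ^ 2) * gf2 UNIV block_slope block_cost) i =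
      fps_nth (fps_const (1 + T) * (Z ^ 2 + fps_const T) + fps_const (2 * T) * Z) i"
    by (simp add: fps_X_power_nth fps_X_nth)
qed

lemma finite_point_cost_le: "finite {p. point_cost p \<le> k}"
  by (rule finite_subset[of _ "{- int k..int k}"]) (auto simp: point_cost_def)

lemma finite_block_cost_le: "finite {z. block_cost z \<le> k}"
  by (rule finite_subset[of _ "{- int k..int k} \<times> {- int k..int k}"])
    (auto simp: block_cost_def rho_def nat_le_iff min_def max_def split: if_splits)

definition config_cost :: "int \<times> (int \<times> int) list \<Rightarrow> nat" where
  "config_cost = (\<lambda>(p, zs). point_cost p + (\<Sum>z\<leftarrow>zs. block_cost z))"

definition config_slope :: "int \<times> (int \<times> int) list \<Rightarrow> nat" where
  "config_slope = (\<lambda>(p, zs). point_slope p + (\<Sum>z\<leftarrow>zs. block_slope z))"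

text \<open>The items are independent, so their series multiply. The point takes one factor 1 - T
  and each block two, in total 2n + 1, the dimension plus one.\<close>

lemma gf2_config:
  "fps_const ((1 - T) ^ (2*n + 1)) * gf2 (UNIV \<times> {zs. length zs = n}) config_slope config_cost
   = (Z ^ 2 + fps_const T) * (fps_const (1 + T) * (Z ^ 2 + fps_const T) + fps_const (2 * T) * Z) ^ n"
proof -
  have "gf2 (UNIV \<times> {zs. length zs = n}) config_slope config_cost =
      gf2 UNIV point_slope point_cost * gf2 UNIV block_slope block_cost ^ n"
    unfolding config_slope_def config_cost_def gf2_lists[OF finite_block_cost_le, symmetric]
    by (rule gf2_Times)
      (use finite_point_cost_le finite_lists_sum_le[OF finite_block_cost_le, of n] in simp_all)
  moreover have "fps_const ((1 - T) ^ (2*n + 1)) = fps_const (1 - T) * fps_const ((1 - T) ^ 2) ^ n"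
    by (simp add: power_mult)
  ultimately have "fps_const ((1 - T) ^ (2*n + 1)) * gf2 (UNIV \<times> {zs. length zs = n}) config_slope config_cost
    = (fps_const (1 - T) * gf2 UNIV point_slope point_cost) *
      (fps_const ((1 - T) ^ 2) * gf2 UNIV block_slope block_cost) ^ n"
    by (simp only: power_mult_distrib mult_ac)
  then show ?thesis by (simp only: gf2_point gf2_block)
qed

text \<open>A configuration of cost c and increment \<sigma> is counted for m = c, ..., c + \<sigma>
  - 1, so it contributes T^c (1 + T + ... + T^(\<sigma>-1)), and nothing if \<sigma> \<le>
  0.\<close>

lemma card_escaping_configs:
  "int (card {x \<in> UNIV \<times> {zs. length zs = n}. config_cost x \<le> m \<and> m < config_cost x + (config_slope x - n - 1)})
   = fps_nth (\<Sum>\<tau>\<le>2*n + 2. (\<Sum>i<\<tau> - n - 1. T ^ i) *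
       fps_nth (gf2 (UNIV \<times> {zs. length zs = n}) config_slope config_cost) \<tau>) m"
proof -
  define W :: "(int \<times> (int \<times> int) list) set" where "W = UNIV \<times> {zs. length zs = n}"
  define F where "F \<tau> k = {x \<in> W. config_slope x = \<tau> \<and> config_cost x = k}" for \<tau> k
  have slope_le: "config_slope x \<le> 2*n + 2" if "x \<in> W" for x
  proof -
    have "(\<Sum>z\<leftarrow>zs. block_slope z) \<le> 2 * length zs" for zs
    proof (induction zs)
      case (Cons z zs)
      then show ?case using block_slope_le[of z] by simp
    qed simp
    moreover have "point_slope p \<le> 2" for p
      by (simp add: point_slope_def)
    ultimately show ?thesis
      using that add_mono[of "point_slope (fst x)" 2 "\<Sum>z\<leftarrow>snd x. block_slope z" "2 * n"]
      by (auto simp: W_def config_slope_def)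
  qed
  have fin: "finite (F \<tau> k)" for \<tau> k
  proof (rule finite_subset)
    show "F \<tau> k \<subseteq> {p. point_cost p \<le> k} \<times> {zs. length zs = n \<and> (\<Sum>z\<leftarrow>zs. block_cost z) \<le> k}"
      by (auto simp: F_def W_def config_cost_def)
    show "finite ({p. point_cost p \<le> k} \<times> {zs. length zs = n \<and> (\<Sum>z\<leftarrow>zs. block_cost z) \<le> k})"
      by (intro finite_cartesian_product finite_point_cost_le finite_lists_sum_le finite_block_cost_le)
  qed
  \<comment> \<open>The index i is the slack m - cost. The bound \<open>i \<le> m\<close> keeps m -
    i from being truncated, which would count the configurations of cost 0 repeatedly.\<close>
  define I where "I \<tau> = {i. i < \<tau> - n - 1 \<and> i \<le> m}" for \<tau>
  have finI: "finite (I \<tau>)" for \<tau> unfolding I_def by simp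
  have "{x \<in> W. config_cost x \<le> m \<and> m < config_cost x + (config_slope x - n - 1)}
      = (\<Union>(\<tau>, i)\<in>(SIGMA \<tau>:{..2*n + 2}. I \<tau>). F \<tau> (m - i))" (is "?L = ?R")
  proof
    show "?R \<subseteq> ?L" by (auto simp: F_def I_def)
    show "?L \<subseteq> ?R"
    proof
      fix x assume x: "x \<in> ?L"
      then have "(config_slope x, m - config_cost x) \<in> (SIGMA \<tau>:{..2*n + 2}. I \<tau>)"
        "x \<in> F (config_slope x) (m - (m - config_cost x))"
        using slope_le[of x] by (auto simp: F_def I_def)
      then show "x \<in> ?R" by blast
    qed
  qed
  also have "card \<dots> = (\<Sum>(\<tau>, i)\<in>(SIGMA \<tau>:{..2*n + 2}. I \<tau>). card (F \<tau> (m - i)))"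
  proof (subst card_UN_disjoint)
    show "finite (SIGMA \<tau>:{..2*n + 2}. I \<tau>)" using finI by auto
    show "\<forall>z\<in>SIGMA \<tau>:{..2*n + 2}. I \<tau>. finite (case z of (\<tau>, i) \<Rightarrow> F \<tau> (m - i))"
      using fin by auto
    show "\<forall>z\<in>SIGMA \<tau>:{..2*n + 2}. I \<tau>. \<forall>z'\<in>SIGMA \<tau>:{..2*n + 2}. I \<tau>. z \<noteq> z' \<longrightarrow>
        (case z of (\<tau>, i) \<Rightarrow> F \<tau> (m - i)) \<inter> (case z' of (\<tau>, i) \<Rightarrow> F \<tau> (m - i)) = {}"
      by (auto simp: F_def I_def)
  qed (auto simp: case_prod_unfold)
  also have "\<dots> = (\<Sum>\<tau>\<le>2*n + 2. \<Sum>i\<in>I \<tau>. card (F \<tau> (m - i)))"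
    by (rule sum.Sigma[symmetric]) (use finI in auto)
  also have "int \<dots> = (\<Sum>\<tau>\<le>2*n + 2. \<Sum>i<\<tau> - n - 1. if m < i then 0 else int (card (F \<tau> (m - i))))"
    unfolding of_nat_sum I_def
    by (intro sum.cong refl sum.mono_neutral_cong_left) auto
  finally show ?thesis
    by (simp only: W_def F_def fps_sum_nth sum_distrib_right fps_X_power_mult_nth gf2_nth)
qed

lemma escaping_configs_gf:
  "(1 - T) * (Abs_fps (\<lambda>m. int (card {x \<in> UNIV \<times> {zs. length zs = n}.
      config_cost x \<le> m \<and> m < config_cost x + (config_slope x - n - 1)})) * (1 - T) ^ (2*n + 1))
   = fps_of_poly (cyc_sum n)"
proof -
  let ?G = "gf2 (UNIV \<times> {zs. length zs = n}) config_slope config_cost"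
  have geo: "(1 - T) * (\<Sum>i<d. T ^ i) = 1 - T ^ d" for d
    by (simp add: one_diff_power_eq)
  have "Abs_fps (\<lambda>m. int (card {x \<in> UNIV \<times> {zs. length zs = n}.
      config_cost x \<le> m \<and> m < config_cost x + (config_slope x - n - 1)}))
    = (\<Sum>\<tau>\<le>2*n + 2. (\<Sum>i<\<tau> - n - 1. T ^ i) * fps_nth ?G \<tau>)"
    by (rule fps_ext) (simp only: card_escaping_configs fps_nth_Abs_fps)
  then have "(1 - T) * (Abs_fps (\<lambda>m. int (card {x \<in> UNIV \<times> {zs. length zs = n}.
      config_cost x \<le> m \<and> m < config_cost x + (config_slope x - n - 1)})) * (1 - T) ^ (2*n + 1))
    = (\<Sum>\<tau>\<le>2*n + 2. ((1 - T) * (\<Sum>i<\<tau> - n - 1. T ^ i)) * ((1 - T) ^ (2*n + 1) * fps_nth ?G \<tau>))"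
    by (simp only: sum_distrib_left sum_distrib_right mult_ac)
  also have "\<dots> = (\<Sum>\<tau>\<le>2*n + 2. (1 - T ^ (\<tau> - n - 1)) *
      fps_nth (fps_const ((1 - T) ^ (2*n + 1)) * ?G) \<tau>)"
    unfolding geo fps_mult_left_const_nth ..
  also have "\<dots> = fps_of_poly (cyc_sum n)"
    unfolding gf2_config by (rule weighted_coeff_sum)
  finally show ?thesis .
qed

section \<open>Flow cost as a convex function of the circulation\<close>

definition flow_cost :: "('a::linordered_idom \<times> 'a) list \<Rightarrow> 'a \<Rightarrow> 'a" where
  "flow_cost zs s = \<bar>s\<bar> + (\<Sum>(b, y)\<leftarrow>zs. rho b (y - s))"

definition shift :: "int \<Rightarrow> (int \<times> int) list \<Rightarrow> (int \<times> int) list" where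
  "shift p zs = map (\<lambda>(b, y). (b, y - p)) zs"

lemma length_shift [simp]: "length (shift p zs) = length zs"
  by (simp add: shift_def)

lemma shift_shift: "shift p (shift q zs) = shift (p + q) zs"
  by (simp add: shift_def case_prod_unfold comp_def algebra_simps)

lemma shift_0 [simp]: "shift 0 zs = zs"
  by (simp add: shift_def)

text \<open>Evaluating the shifted list at \<open>- p\<close> undoes the shift. A configuration thus
  encodes a list together with a circulation s = -p, seen from s.\<close>

lemma config_cost_eq: "int (config_cost (p, zs)) = flow_cost (shift p zs) (- p)"
proof -
  have "int (\<Sum>z\<leftarrow>zs. block_cost z) = (\<Sum>(b, y)\<leftarrow>zs. rho b y)"
    by (induction zs) (auto simp: block_cost_def rho_nonneg)
  then show ?thesis
    by (simp add: config_cost_def point_cost_def flow_cost_def shift_def comp_def case_prod_unfold)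
qed

lemma config_slope_eq:
  "int (config_slope (p, zs)) =
    flow_cost (shift p zs) (1 - p) - flow_cost (shift p zs) (- p) + int (length zs) + 1"
proof -
  have "int (\<Sum>z\<leftarrow>zs. block_slope z) = (\<Sum>(b, y)\<leftarrow>zs. rho b (y - 1)) - (\<Sum>(b, y)\<leftarrow>zs. rho b y) + int (length zs)"
  proof (induction zs)
    case (Cons z zs)
    then show ?case using rho_step(1)[of "fst z" "snd z"] by (auto simp: block_slope_def case_prod_unfold)
  qed simp
  moreover have "int (point_slope p) = \<bar>1 - p\<bar> - \<bar>p\<bar> + 1"
    unfolding point_slope_def by arith
  ultimately show ?thesis
    by (simp add: config_slope_def flow_cost_def shift_def comp_def case_prod_unfold algebra_simps)
qed

lemma escaping_iff:
  assumes "length zs = n"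
  shows "config_cost (p, zs) \<le> m \<and> m < config_cost (p, zs) + (config_slope (p, zs) - n - 1) \<longleftrightarrow>
    flow_cost (shift p zs) (- p) \<le> int m \<and> int m < flow_cost (shift p zs) (1 - p)"
  using config_cost_eq[of p zs] config_slope_eq[of p zs] assms by linarith

lemma flow_cost_convex:
  fixes s s' :: int
  assumes "s \<le> s'"
  shows "flow_cost zs (s + 1) - flow_cost zs s \<le> flow_cost zs (s' + 1) - flow_cost zs s'"
proof -
  have "(\<Sum>(b, y)\<leftarrow>zs. rho b (y - (s + 1))) - (\<Sum>(b, y)\<leftarrow>zs. rho b (y - s))
      \<le> (\<Sum>(b, y)\<leftarrow>zs. rho b (y - (s' + 1))) - (\<Sum>(b, y)\<leftarrow>zs. rho b (y - s'))"
  proof (induction zs)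
    case (Cons z zs)
    then show ?case
      using rho_convex[of "snd z - s'" "snd z - s" "fst z"] assms by (auto simp: case_prod_unfold algebra_simps)
  qed simp
  moreover have "\<bar>s + 1\<bar> - \<bar>s\<bar> \<le> \<bar>s' + 1\<bar> - \<bar>s'\<bar>" using assms by auto
  ultimately show ?thesis by (simp add: flow_cost_def)
qed

lemma flow_cost_ge_abs: "\<bar>s\<bar> \<le> flow_cost zs s"
  unfolding flow_cost_def by (induction zs) (auto simp: rho_nonneg intro: add_increasing)

text \<open>The increment at s is positive, and by convexity all later increments are at least as
  large.\<close>

lemma flow_cost_stays_above:
  fixes s s' :: int
  assumes "flow_cost zs s \<le> m" "m < flow_cost zs (s + 1)" "s < s'"
  shows "m < flow_cost zs s'"
proof -
  have "m < flow_cost zs (s + 1 + int k)" for k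
  proof (induction k)
    case (Suc k)
    then show ?case
      using flow_cost_convex[of s "s + 1 + int k" zs] assms(1,2) by (simp add: algebra_simps)
  qed (use assms in simp)
  from this[of "nat (s' - s - 1)"] show ?thesis using assms(3) by simp
qed

text \<open>A list of cost at most \<open>m\<close> is paired with the largest shift that keeps the cost at most \<open>m\<close>;
  by convexity it is the only shift at which the cost passes from at most \<open>m\<close> to more than \<open>m\<close>.\<close>

lemma card_reachable_eq_card_escaping:
  "card {zs. length zs = n \<and> (\<exists>s. flow_cost zs s \<le> int m)} =
   card {x \<in> UNIV \<times> {zs. length zs = n}. config_cost x \<le> m \<and> m < config_cost x + (config_slope x - n - 1)}"
  (is "card ?R = card ?E")
proof -
  have E: "?E = {(p, zs). length zs = n \<and> flow_cost (shift p zs) (- p) \<le> int m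
      \<and> int m < flow_cost (shift p zs) (- p + 1)}"
    using escaping_iff[of _ n _ m] by (auto simp: add.commute)
  have "bij_betw (\<lambda>(p, zs). shift p zs) ?E ?R"
  proof (rule bij_betw_imageI)
    show "inj_on (\<lambda>(p, zs). shift p zs) ?E"
      unfolding E
    proof (intro inj_onI, clarify)
      fix p zs q ws
      assume eq: "shift p zs = shift q ws"
        and p: "flow_cost (shift p zs) (- p) \<le> int m" "int m < flow_cost (shift p zs) (- p + 1)"
        and q: "flow_cost (shift q ws) (- q) \<le> int m" "int m < flow_cost (shift q ws) (- q + 1)"
      \<comment> \<open>Of two different shifts at which the cost crosses m, the later one would
        already have cost above m.\<close>
      have "p = q"
        using flow_cost_stays_above[OF p, of "- q"] flow_cost_stays_above[OF q, of "- p"] p q eq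
        by (cases p q rule: linorder_cases) auto
      moreover from this eq have "zs = ws"
        by (metis shift_shift shift_0 add.left_inverse)
      ultimately show "p = q \<and> zs = ws" ..
    qed
    show "(\<lambda>(p, zs). shift p zs) ` ?E = ?R"
    proof
      show "(\<lambda>(p, zs). shift p zs) ` ?E \<subseteq> ?R" unfolding E by auto
      show "?R \<subseteq> (\<lambda>(p, zs). shift p zs) ` ?E"
      proof
        fix zs assume "zs \<in> ?R"
        then obtain s0 where zs: "length zs = n" and s0: "flow_cost zs s0 \<le> int m" by blast
        define A where "A = {s. flow_cost zs s \<le> int m}"
        \<comment> \<open>The cost is at least |s|, so only finitely many s stay within the bound
          and a largest one exists.\<close>
        have "A \<subseteq> {- int m..int m}"
        proof
          fix s assume "s \<in> A"
          then show "s \<in> {- int m..int m}" using flow_cost_ge_abs[of s zs] by (auto simp: A_def)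
        qed
        then have finA: "finite A" by (rule finite_subset) simp
        define s where "s = Max A"
        have "s \<in> A" unfolding s_def using finA s0 by (intro Max_in) (auto simp: A_def)
        moreover have "s + 1 \<notin> A" using Max_ge[OF finA, of "s + 1"] unfolding s_def by auto
        ultimately have "(- s, shift s zs) \<in> ?E"
          unfolding E using zs by (auto simp: A_def shift_shift add.commute)
        moreover have "zs = shift (- s) (shift s zs)" by (simp add: shift_shift)
        ultimately show "zs \<in> (\<lambda>(p, zs). shift p zs) ` ?E" by force
      qed
    qed
  qed
  from bij_betw_same_card[OF this] show ?thesis by simp
qed

section \<open>Optimal flow in a triangle, and integrality of the optimal circulation\<close>

lemma rho_le_flow: "rho b y \<le> \<bar>a\<bar> + \<bar>b + a\<bar> + \<bar>y - a\<bar>" for b y a :: real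
  by (auto simp: rho_def min_def max_def)

text \<open>The left-hand side sums the distances of a from 0, -b and y, so it is smallest at their
  median. The witness is the median, written as y clamped to the interval between 0 and -b.\<close>

lemma rho_attained: "\<exists>a. \<bar>a\<bar> + \<bar>b + a\<bar> + \<bar>y - a\<bar> = rho b y" for b y :: real
  by (rule exI[of _ "max (min 0 (- b)) (min (max 0 (- b)) y)"]) (auto simp: rho_def min_def max_def)

text \<open>The right-hand side sums the pairwise distances of 0, -b and y, each end of the range
  being joined to the other both directly and through the middle number.\<close>

lemma rho_eq_half_sum: "2 * rho b y = \<bar>b\<bar> + \<bar>y\<bar> + \<bar>y + b\<bar>" for b y :: real
  by (auto simp: rho_def min_def max_def)

lemma rho_of_int: "rho (real_of_int b) (real_of_int y) = real_of_int (rho b y)"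
  by (simp add: rho_def flip: of_int_minus of_int_max of_int_min)

text \<open>The only kink is at the integer a, so the function is affine between consecutive
  integers.\<close>

lemma abs_int_diff_interpolate:
  fixes a k :: int and t :: real
  assumes "0 \<le> t" "t \<le> 1"
  shows "\<bar>of_int a - (of_int k + t)\<bar> = (1 - t) * \<bar>of_int (a - k)\<bar> + t * \<bar>of_int (a - (k + 1))\<bar>"
proof (cases "a \<le> k")
  case True
  then have "real_of_int a \<le> real_of_int k" by simp
  then have "\<bar>of_int a - (of_int k + t)\<bar> = of_int k + t - of_int a"
    "\<bar>real_of_int (a - k)\<bar> = of_int k - of_int a" "\<bar>real_of_int (a - (k + 1))\<bar> = of_int k + 1 - of_int a"
    using assms by auto
  then show ?thesis by (simp add: algebra_simps)
next
  case False
  then have "real_of_int a \<ge> real_of_int (k + 1)" by linarith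
  then have "\<bar>of_int a - (of_int k + t)\<bar> = of_int a - (of_int k + t)"
    "\<bar>real_of_int (a - k)\<bar> = of_int a - of_int k" "\<bar>real_of_int (a - (k + 1))\<bar> = of_int a - of_int k - 1"
    using assms by auto
  then show ?thesis by (simp add: algebra_simps)
qed

lemma rho_interpolate:
  fixes b y k :: int and t :: real
  assumes "0 \<le> t" "t \<le> 1"
  shows "rho (of_int b) (of_int y - (of_int k + t)) =
    (1 - t) * of_int (rho b (y - k)) + t * of_int (rho b (y - (k + 1)))"
proof -
  have "2 * rho (of_int b) (of_int y - (of_int k + t)) =
      \<bar>of_int b\<bar> + \<bar>of_int y - (of_int k + t)\<bar> + \<bar>of_int (y + b) - (of_int k + t)\<bar>"
    unfolding rho_eq_half_sum by (simp add: algebra_simps)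
  also have "\<dots> = (1 - t) * (\<bar>of_int b\<bar> + \<bar>of_int (y - k)\<bar> + \<bar>of_int (y - k) + of_int b\<bar>)
     + t * (\<bar>of_int b\<bar> + \<bar>of_int (y - (k + 1))\<bar> + \<bar>of_int (y - (k + 1)) + of_int b\<bar>)"
    unfolding abs_int_diff_interpolate[OF assms] by (simp add: algebra_simps)
  also have "\<dots> = 2 * ((1 - t) * of_int (rho b (y - k)) + t * of_int (rho b (y - (k + 1))))"
    unfolding rho_eq_half_sum[symmetric] rho_of_int by (simp add: algebra_simps)
  finally show ?thesis by simp
qed

abbreviation real_pairs :: "(int \<times> int) list \<Rightarrow> (real \<times> real) list" where
  "real_pairs zs \<equiv> map (\<lambda>(b, y). (of_int b, of_int y)) zs"

lemma flow_cost_interpolate: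
  fixes k :: int and t :: real
  assumes "0 \<le> t" "t \<le> 1"
  shows "flow_cost (real_pairs zs) (of_int k + t) =
    (1 - t) * of_int (flow_cost zs k) + t * of_int (flow_cost zs (k + 1))"
proof -
  have "(\<Sum>(b, y)\<leftarrow>real_pairs zs. rho b (y - (of_int k + t))) =
    (1 - t) * of_int (\<Sum>(b, y)\<leftarrow>zs. rho b (y - k)) + t * of_int (\<Sum>(b, y)\<leftarrow>zs. rho b (y - (k + 1)))"
  proof (induction zs)
    case (Cons z zs)
    then show ?case
      using rho_interpolate[OF assms, of "fst z" "snd z" k] by (auto simp: case_prod_unfold algebra_simps)
  qed simp
  moreover have "\<bar>of_int k + t\<bar> = (1 - t) * \<bar>of_int k\<bar> + t * \<bar>of_int (k + 1)\<bar>"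
    using abs_int_diff_interpolate[OF assms, of 0 k]
    by (simp only: of_int_0 diff_0 of_int_minus abs_minus_cancel)
  ultimately show ?thesis by (simp add: flow_cost_def algebra_simps)
qed

text \<open>The cost is affine between consecutive integers, so if both integer neighbours of s
  exceed the bound, s exceeds it as well.\<close>

lemma real_flow_cost_le_iff:
  "(\<exists>s. flow_cost (real_pairs zs) s \<le> of_nat m) \<longleftrightarrow> (\<exists>s. flow_cost zs s \<le> int m)"
proof
  assume "\<exists>s. flow_cost (real_pairs zs) s \<le> of_nat m"
  then obtain s where s: "flow_cost (real_pairs zs) s \<le> of_nat m" by blast
  define k t where "k = \<lfloor>s\<rfloor>" and "t = frac s"
  have t: "0 \<le> t" "t < 1" and st: "s = of_int k + t"
    using frac_lt_1[of s] by (auto simp: k_def t_def frac_def)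
  show "\<exists>s. flow_cost zs s \<le> int m"
  proof (rule ccontr)
    assume "\<not> (\<exists>s. flow_cost zs s \<le> int m)"
    then have "int m < flow_cost zs k" "int m < flow_cost zs (k + 1)" by (auto simp: not_le)
    then have "real m < of_int (flow_cost zs k)" "real m < of_int (flow_cost zs (k + 1))" by linarith+
    then have "(1 - t) * real m + t * real m < (1 - t) * of_int (flow_cost zs k) + t * of_int (flow_cost zs (k + 1))"
      using t by (intro add_less_le_mono mult_strict_left_mono mult_left_mono) auto
    then show False using s t unfolding st by (subst (asm) flow_cost_interpolate) (auto simp: algebra_simps)
  qed
next
  assume "\<exists>s. flow_cost zs s \<le> int m"
  then obtain s where "flow_cost zs s \<le> int m" by blast
  then have "flow_cost (real_pairs zs) (of_int s + 0) \<le> of_nat m"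
    by (subst flow_cost_interpolate) simp_all
  then show "\<exists>s. flow_cost (real_pairs zs) s \<le> of_nat m" by blast
qed

section \<open>Lattice points of the dilates\<close>

no_notation fps_nth (infixl "$" 75)

text \<open>The hull is the linear image of the cross-polytope, the unit ball of the sum
  norm.\<close>

lemma convex_hull_signed_vectors:
  fixes w :: "'i \<Rightarrow> 'a::real_vector"
  assumes "finite I" "I \<noteq> {}"
  shows "convex hull (\<Union>i\<in>I. {w i, - w i}) = {\<Sum>i\<in>I. f i *\<^sub>R w i | f. (\<Sum>i\<in>I. \<bar>f i\<bar>) \<le> 1}"
    (is "?H = ?K")
proof
  show "?H \<subseteq> ?K"
  proof (rule hull_minimal)
    show "(\<Union>i\<in>I. {w i, - w i}) \<subseteq> ?K"
    proof clarify
      fix i x assume i: "i \<in> I" and x: "x \<in> {w i, - w i}"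
      then obtain c :: real where c: "x = c *\<^sub>R w i" "\<bar>c\<bar> = 1"
        by (metis abs_minus_cancel abs_one empty_iff insert_iff scaleR_minus1_left scaleR_one)
      have "x = (\<Sum>j\<in>I. (if j = i then c else 0) *\<^sub>R w j)" "(\<Sum>j\<in>I. \<bar>if j = i then c else 0\<bar>) = 1"
        using i assms(1) c by (simp_all add: if_distrib[of abs] if_distrib[of "\<lambda>r. r *\<^sub>R _"] sum.delta cong: if_cong)
      then show "\<exists>f. x = (\<Sum>i\<in>I. f i *\<^sub>R w i) \<and> (\<Sum>i\<in>I. \<bar>f i\<bar>) \<le> 1"
        by (metis order_refl)
    qed
    show "convex ?K"
    proof (intro convexI, clarify)
      fix a b :: real and f g :: "'i \<Rightarrow> real"
      assume ab: "0 \<le> a" "0 \<le> b" "a + b = 1"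
        and f: "(\<Sum>i\<in>I. \<bar>f i\<bar>) \<le> 1" and g: "(\<Sum>i\<in>I. \<bar>g i\<bar>) \<le> 1"
      have "(\<Sum>i\<in>I. \<bar>a * f i + b * g i\<bar>) \<le> (\<Sum>i\<in>I. a * \<bar>f i\<bar> + b * \<bar>g i\<bar>)"
        using ab by (intro sum_mono order.trans[OF abs_triangle_ineq]) (simp add: abs_mult)
      also have "\<dots> \<le> a * 1 + b * 1"
        unfolding sum.distrib sum_distrib_left[symmetric] using ab f g by (intro add_mono mult_left_mono)
      finally have "(\<Sum>i\<in>I. \<bar>a * f i + b * g i\<bar>) \<le> 1" using ab by simp
      moreover have "a *\<^sub>R (\<Sum>i\<in>I. f i *\<^sub>R w i) + b *\<^sub>R (\<Sum>i\<in>I. g i *\<^sub>R w i) = (\<Sum>i\<in>I. (a * f i + b * g i) *\<^sub>R w i)"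
        by (simp add: scaleR_sum_right sum.distrib scaleR_add_left)
      ultimately show "\<exists>h. a *\<^sub>R (\<Sum>i\<in>I. f i *\<^sub>R w i) + b *\<^sub>R (\<Sum>i\<in>I. g i *\<^sub>R w i) = (\<Sum>i\<in>I. h i *\<^sub>R w i)
          \<and> (\<Sum>i\<in>I. \<bar>h i\<bar>) \<le> 1"
        by (intro exI[of _ "\<lambda>i. a * f i + b * g i"]) simp
    qed
  qed
  show "?K \<subseteq> ?H"
  proof clarify
    fix f :: "'i \<Rightarrow> real" assume f: "(\<Sum>i\<in>I. \<bar>f i\<bar>) \<le> 1"
    define c where "c = (\<Sum>i\<in>I. \<bar>f i\<bar>)"
    have mem: "w i \<in> ?H" "- w i \<in> ?H" if "i \<in> I" for i
      using that by (auto intro!: hull_inc)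
    obtain i0 where "i0 \<in> I" using assms(2) by blast
    \<comment> \<open>Zero is the midpoint of w i0 and - w i0.\<close>
    from convexD[OF convex_convex_hull mem[OF this], of "1/2" "1/2"] have zero: "0 \<in> ?H" by simp
    show "(\<Sum>i\<in>I. f i *\<^sub>R w i) \<in> ?H"
    proof (cases "c = 0")
      case True
      then have "f i = 0" if "i \<in> I" for i
        using that assms(1) by (simp add: c_def sum_nonneg_eq_0_iff)
      then show ?thesis using zero by simp
    next
      case False
      then have c: "c > 0" by (simp add: c_def order_less_le sum_nonneg)
      \<comment> \<open>The weights |f i| / c go with the vectors sgn (f i) w i. Where f i = 0 the
        second summand inserts w i instead of 0, so that the vector lies in the hull; its weight is
        0.\<close>
      have "(\<Sum>i\<in>I. (\<bar>f i\<bar> / c) *\<^sub>R (sgn (f i) *\<^sub>R w i + (1 - \<bar>sgn (f i)\<bar>) *\<^sub>R w i)) \<in> ?H"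
      proof (rule convex_sum[OF assms(1) convex_convex_hull])
        show "(\<Sum>i\<in>I. \<bar>f i\<bar> / c) = 1" using c by (simp add: c_def flip: sum_divide_distrib)
        show "0 \<le> \<bar>f i\<bar> / c" for i using c by simp
        show "sgn (f i) *\<^sub>R w i + (1 - \<bar>sgn (f i)\<bar>) *\<^sub>R w i \<in> ?H" if "i \<in> I" for i
          using mem[OF that] by (cases "f i" "0::real" rule: linorder_cases) auto
      qed
      moreover have "(\<bar>a\<bar> / c) *\<^sub>R (sgn a *\<^sub>R x + (1 - \<bar>sgn a\<bar>) *\<^sub>R x) = (1 / c) *\<^sub>R (a *\<^sub>R x)" for a :: real and x :: 'a
        by (cases a "0::real" rule: linorder_cases) (auto simp: sgn_if)
      ultimately have "(1 / c) *\<^sub>R (\<Sum>i\<in>I. f i *\<^sub>R w i) \<in> ?H"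
        by (simp add: scaleR_sum_right)
      \<comment> \<open>Scaling back by c \<le> 1 is mixing with 0.\<close>
      from convexD[OF convex_convex_hull this zero, of c "1 - c"] c f show ?thesis
        by (simp add: c_def)
    qed
  qed
qed

lemma scaled_convex_hull_signed_vectors:
  fixes w :: "'i \<Rightarrow> 'a::real_vector"
  assumes "finite I" "I \<noteq> {}" "r \<ge> 0"
  shows "(\<lambda>y. r *\<^sub>R y) ` (convex hull (\<Union>i\<in>I. {w i, - w i})) = {\<Sum>i\<in>I. f i *\<^sub>R w i | f. (\<Sum>i\<in>I. \<bar>f i\<bar>) \<le> r}"
    (is "?H = ?K")
proof
  have sc: "r *\<^sub>R (\<Sum>i\<in>I. f i *\<^sub>R w i) = (\<Sum>i\<in>I. (r * f i) *\<^sub>R w i)"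
    "(\<Sum>i\<in>I. \<bar>r * f i\<bar>) = r * (\<Sum>i\<in>I. \<bar>f i\<bar>)" for f
    using assms(3) by (simp_all add: scaleR_sum_right abs_mult sum_distrib_left)
  show "?H \<subseteq> ?K"
  proof (unfold convex_hull_signed_vectors[OF assms(1,2)], clarify)
    fix f :: "'i \<Rightarrow> real" assume "(\<Sum>i\<in>I. \<bar>f i\<bar>) \<le> 1"
    then have le: "(\<Sum>i\<in>I. \<bar>r * f i\<bar>) \<le> r" unfolding sc using assms(3) by (simp add: mult_left_le)
    then show "\<exists>g. r *\<^sub>R (\<Sum>i\<in>I. f i *\<^sub>R w i) = (\<Sum>i\<in>I. g i *\<^sub>R w i) \<and> (\<Sum>i\<in>I. \<bar>g i\<bar>) \<le> r"
      using le unfolding sc(1) by (intro exI[of _ "\<lambda>i. r * f i"]) simp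
  qed
  show "?K \<subseteq> ?H"
  proof (unfold convex_hull_signed_vectors[OF assms(1,2)], clarify)
    fix f :: "'i \<Rightarrow> real" assume f: "(\<Sum>i\<in>I. \<bar>f i\<bar>) \<le> r"
    have "\<exists>g. (\<forall>i\<in>I. f i = r * g i) \<and> (\<Sum>i\<in>I. \<bar>g i\<bar>) \<le> 1"
    proof (cases "r = 0")
      case True
      then have "(\<Sum>i\<in>I. \<bar>f i\<bar>) = 0" using f by (simp add: antisym sum_nonneg)
      then have "\<forall>i\<in>I. f i = 0" using assms(1) by (simp add: sum_nonneg_eq_0_iff)
      then show ?thesis by (intro exI[of _ "\<lambda>_. 0"]) simp
    next
      case False
      then have "(\<Sum>i\<in>I. \<bar>f i / r\<bar>) \<le> 1" using f assms(3) by (simp flip: sum_divide_distrib)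
      then show ?thesis using False by (intro exI[of _ "\<lambda>i. f i / r"]) simp
    qed
    then obtain g where g: "\<forall>i\<in>I. f i = r * g i" "(\<Sum>i\<in>I. \<bar>g i\<bar>) \<le> 1" by blast
    then have "(\<Sum>i\<in>I. f i *\<^sub>R w i) = r *\<^sub>R (\<Sum>i\<in>I. g i *\<^sub>R w i)" by (simp add: sc)
    with g(2) show "(\<Sum>i\<in>I. f i *\<^sub>R w i) \<in> (\<lambda>y. r *\<^sub>R y) ` {\<Sum>i\<in>I. f i *\<^sub>R w i | f. (\<Sum>i\<in>I. \<bar>f i\<bar>) \<le> 1}"
      by blast
  qed
qed

section \<open>The graph, its edge vectors and their flows\<close>

locale gamma =
  fixes n :: nat and u v :: "nat \<Rightarrow> 'v::finite"
  assumes n: "n \<ge> 1" and vertices: "Gamma_vertices n u v"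
begin

definition P :: "(real ^ 'v) set" where
  "P = sym_edge_polytope (Gamma_edges n u v)"

lemma inj_u: "i \<in> {1..n+1} \<Longrightarrow> j \<in> {1..n+1} \<Longrightarrow> u i = u j \<longleftrightarrow> i = j"
  using vertices by (auto simp: Gamma_vertices_def dest: inj_onD)

lemma inj_v: "i \<in> {1..n} \<Longrightarrow> j \<in> {1..n} \<Longrightarrow> v i = v j \<longleftrightarrow> i = j"
  using vertices by (auto simp: Gamma_vertices_def dest: inj_onD)

lemma u_neq_v: "i \<in> {1..n+1} \<Longrightarrow> j \<in> {1..n} \<Longrightarrow> u i \<noteq> v j"
  using vertices unfolding Gamma_vertices_def by blast

lemma axis_components:
  assumes "i \<in> {1..n+1}" "j \<in> {1..n+1}"
  shows "axis (u j) c $ u i = (if i = j then c else 0)"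
    and "i \<in> {1..n} \<Longrightarrow> axis (u j) c $ v i = 0"
    and "j \<in> {1..n} \<Longrightarrow> axis (v j) c $ u i = 0"
    and "i \<in> {1..n} \<Longrightarrow> j \<in> {1..n} \<Longrightarrow> axis (v j) c $ v i = (if i = j then c else 0)"
  using inj_u[OF assms] inj_v[of i j] u_neq_v[of i j] u_neq_v[of j i] assms by (auto simp: axis_def)

lemma sum_vertices: "(\<Sum>w\<in>UNIV. h w) = (\<Sum>i=1..n+1. h (u i)) + (\<Sum>i=1..n. h (v i))"
  for h :: "'v \<Rightarrow> 'b::comm_monoid_add"
proof -
  have "sum h UNIV = sum h (u ` {1..n+1} \<union> v ` {1..n})"
    using vertices by (simp add: Gamma_vertices_def)
  also have "\<dots> = sum h (u ` {1..n+1}) + sum h (v ` {1..n})"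
    using vertices by (intro sum.union_disjoint) (auto simp: Gamma_vertices_def)
  also have "\<dots> = (\<Sum>i=1..n+1. h (u i)) + (\<Sum>i=1..n. h (v i))"
    using vertices by (simp only: Gamma_vertices_def sum.reindex o_def)
  finally show ?thesis .
qed

lemma card_vertices: "CARD('v) = 2 * n + 1"
  using sum_vertices[of "\<lambda>_. 1::nat"] by simp

text \<open>Indexing by pairs keeps the parallel edges of n = 1 apart as (1, 2) and (0, 3), so sums
  over edges have the same form for all n. All edges point from left to right.\<close>

definition edge_vec :: "nat \<times> nat \<Rightarrow> real ^ 'v" where
  "edge_vec = (\<lambda>(i, k).
     if k = 0 then axis (u i) 1 - axis (v i) 1
     else if k = 1 then axis (v i) 1 - axis (u (i + 1)) 1
     else if k = 2 then axis (u i) 1 - axis (u (i + 1)) 1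
     else axis (u 1) 1 - axis (u (n + 1)) 1)"

definition edge_idx :: "(nat \<times> nat) set" where
  "edge_idx = insert (0, 3) ({1..n} \<times> {0, 1, 2})"

lemma finite_edge_idx: "finite edge_idx" and edge_idx_nonempty: "edge_idx \<noteq> {}"
  by (simp_all add: edge_idx_def)

lemma sum_edge_idx:
  "(\<Sum>e\<in>edge_idx. h e) = h (0, 3) + (\<Sum>i=1..n. h (i, 0) + h (i, 1) + h (i, 2))"
  for h :: "nat \<times> nat \<Rightarrow> 'b::comm_monoid_add"
proof -
  have "(\<Sum>e\<in>edge_idx. h e) = h (0, 3) + (\<Sum>e\<in>{1..n} \<times> {0, 1, 2}. h e)"
    unfolding edge_idx_def by (subst sum.insert) auto
  also have "(\<Sum>e\<in>{1..n} \<times> {0, 1, 2}. h e) = (\<Sum>i=1..n. \<Sum>k\<in>{0, 1, 2}. h (i, k))"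
    unfolding sum.cartesian_product by (simp add: case_prod_beta')
  finally show ?thesis by (simp add: add.assoc)
qed

lemma P_eq_hull: "P = convex hull (\<Union>e\<in>edge_idx. {edge_vec e, - edge_vec e})"
proof -
  have "\<Union>{{axis i 1 - axis j 1, - (axis i 1 - axis j 1)} | i j. {i, j} \<in> Gamma_edges n u v}
      = (\<Union>e\<in>edge_idx. {edge_vec e, - edge_vec e})" (is "?L = ?R")
  proof
    have "\<exists>e\<in>edge_idx. axis i 1 - axis j 1 = edge_vec e \<or> axis i 1 - axis j 1 = - edge_vec e"
      if "{i, j} \<in> Gamma_edges n u v" for i j
    proof -
      from that consider "{i, j} = {u 1, u (n + 1)}"
        | k where "k \<in> {1..n}" "{i, j} = {u k, u (k + 1)}"
        | k where "k \<in> {1..n}" "{i, j} = {u k, v k}"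
        | k where "k \<in> {1..n}" "{i, j} = {v k, u (k + 1)}"
        unfolding Gamma_edges_def by auto
      then show ?thesis
      proof cases
        case 1
        then show ?thesis
          by (intro bexI[of _ "(0, 3)"]) (auto simp: edge_vec_def edge_idx_def doubleton_eq_iff)
      next
        case 2
        then show ?thesis
          by (intro bexI[of _ "(k, 2)"]) (auto simp: edge_vec_def edge_idx_def doubleton_eq_iff)
      next
        case 3
        then show ?thesis
          by (intro bexI[of _ "(k, 0)"]) (auto simp: edge_vec_def edge_idx_def doubleton_eq_iff)
      next
        case 4
        then show ?thesis
          by (intro bexI[of _ "(k, 1)"]) (auto simp: edge_vec_def edge_idx_def doubleton_eq_iff)
      qed
    qed
    then show "?L \<subseteq> ?R" by fastforce
    have ends: "\<exists>i j. {i, j} \<in> Gamma_edges n u v \<and> edge_vec e = axis i 1 - axis j 1" if "e \<in> edge_idx" for e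
    proof -
      from that consider "e = (0, 3)" | k where "k \<in> {1..n}" "e = (k, 0)"
        | k where "k \<in> {1..n}" "e = (k, 1)" | k where "k \<in> {1..n}" "e = (k, 2)"
        unfolding edge_idx_def by auto
      then show ?thesis
      proof cases
        case 1
        then show ?thesis
          by (intro exI[of _ "u 1"] exI[of _ "u (n + 1)"]) (simp add: edge_vec_def Gamma_edges_def)
      next
        case (2 k)
        then show ?thesis
          by (intro exI[of _ "u k"] exI[of _ "v k"]) (auto simp: edge_vec_def Gamma_edges_def)
      next
        case (3 k)
        then show ?thesis
          by (intro exI[of _ "v k"] exI[of _ "u (k + 1)"]) (auto simp: edge_vec_def Gamma_edges_def)
      next
        case (4 k)
        then show ?thesis
          by (intro exI[of _ "u k"] exI[of _ "u (k + 1)"]) (auto simp: edge_vec_def Gamma_edges_def)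
      qed
    qed
    show "?R \<subseteq> ?L"
    proof (rule UN_least)
      fix e assume "e \<in> edge_idx"
      from ends[OF this] obtain i j where ij: "{i, j} \<in> Gamma_edges n u v" "edge_vec e = axis i 1 - axis j 1"
        by blast
      show "{edge_vec e, - edge_vec e} \<subseteq> ?L"
        unfolding ij(2) by (rule Union_upper) (use ij(1) in blast)
    qed
  qed
  then show ?thesis unfolding P_def sym_edge_polytope_def by simp
qed

text \<open>The divergence of the flow with s on the long edge and a, b, c on the edges from u to v,
  from v to the next u, and from u to the next u.\<close>

definition flow :: "real \<Rightarrow> (nat \<Rightarrow> real) \<Rightarrow> (nat \<Rightarrow> real) \<Rightarrow> (nat \<Rightarrow> real) \<Rightarrow> real ^ 'v" where
  "flow s a b c = s *\<^sub>R edge_vec (0, 3) +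
     (\<Sum>i=1..n. a i *\<^sub>R edge_vec (i, 0) + b i *\<^sub>R edge_vec (i, 1) + c i *\<^sub>R edge_vec (i, 2))"

lemma mem_dilate_iff_flow:
  assumes "r \<ge> 0"
  shows "x \<in> (\<lambda>y. r *\<^sub>R y) ` P \<longleftrightarrow>
    (\<exists>s a b c. \<bar>s\<bar> + (\<Sum>i=1..n. \<bar>a i\<bar> + \<bar>b i\<bar> + \<bar>c i\<bar>) \<le> r \<and> x = flow s a b c)"
  unfolding P_eq_hull scaled_convex_hull_signed_vectors[OF finite_edge_idx edge_idx_nonempty assms] sum_edge_idx
proof
  assume "x \<in> {f (0, 3) *\<^sub>R edge_vec (0, 3) +
      (\<Sum>i=1..n. f (i, 0) *\<^sub>R edge_vec (i, 0) + f (i, 1) *\<^sub>R edge_vec (i, 1) + f (i, 2) *\<^sub>R edge_vec (i, 2)) | f :: nat \<times> nat \<Rightarrow> real.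
      \<bar>f (0, 3)\<bar> + (\<Sum>i=1..n. \<bar>f (i, 0)\<bar> + \<bar>f (i, 1)\<bar> + \<bar>f (i, 2)\<bar>) \<le> r}"
  then obtain f :: "nat \<times> nat \<Rightarrow> real" where
    "\<bar>f (0, 3)\<bar> + (\<Sum>i=1..n. \<bar>f (i, 0)\<bar> + \<bar>f (i, 1)\<bar> + \<bar>f (i, 2)\<bar>) \<le> r"
    "x = flow (f (0, 3)) (\<lambda>i. f (i, 0)) (\<lambda>i. f (i, 1)) (\<lambda>i. f (i, 2))"
    unfolding flow_def by blast
  then show "\<exists>s a b c. \<bar>s\<bar> + (\<Sum>i=1..n. \<bar>a i\<bar> + \<bar>b i\<bar> + \<bar>c i\<bar>) \<le> r \<and> x = flow s a b c"
    by (intro exI conjI)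
next
  assume "\<exists>s a b c. \<bar>s\<bar> + (\<Sum>i=1..n. \<bar>a i\<bar> + \<bar>b i\<bar> + \<bar>c i\<bar>) \<le> r \<and> x = flow s a b c"
  then obtain s a b c where *: "\<bar>s\<bar> + (\<Sum>i=1..n. \<bar>a i\<bar> + \<bar>b i\<bar> + \<bar>c i\<bar>) \<le> r" "x = flow s a b c"
    by blast
  show "x \<in> {f (0, 3) *\<^sub>R edge_vec (0, 3) +
      (\<Sum>i=1..n. f (i, 0) *\<^sub>R edge_vec (i, 0) + f (i, 1) *\<^sub>R edge_vec (i, 1) + f (i, 2) *\<^sub>R edge_vec (i, 2)) | f :: nat \<times> nat \<Rightarrow> real.
      \<bar>f (0, 3)\<bar> + (\<Sum>i=1..n. \<bar>f (i, 0)\<bar> + \<bar>f (i, 1)\<bar> + \<bar>f (i, 2)\<bar>) \<le> r}"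
    using * unfolding flow_def
    by (intro CollectI exI[of _ "\<lambda>(i, k). if k = 0 then a i else if k = 1 then b i else if k = 2 then c i else s"]) simp
qed

section \<open>Coordinates on the vectors of total zero\<close>

text \<open>The flow through block \<open>i\<close> from left to right, up to the circulation along the long cycle.\<close>

definition cut :: "nat \<Rightarrow> real ^ 'v \<Rightarrow> real" where
  "cut i x = (\<Sum>k=1..i. x $ u k) + (\<Sum>k=1..<i. x $ v k)"

definition total :: "real ^ 'v \<Rightarrow> real" where
  "total x = (\<Sum>w\<in>UNIV. x $ w)"

lemma linear_cut: "linear (cut i)"
  by (rule linearI) (simp_all add: cut_def sum.distrib sum_distrib_left distrib_left)

lemma linear_total: "linear total"
  by (rule linearI) (simp_all add: total_def sum.distrib sum_distrib_left)

lemma cut_axis_u: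
  assumes "i \<in> {1..n}" "j \<in> {1..n+1}"
  shows "cut i (axis (u j) 1) = (if j \<le> i then 1 else 0)"
proof -
  have "(\<Sum>k=1..i. axis (u j) 1 $ u k) = (\<Sum>k=1..i. if k = j then 1 else (0::real))"
    using assms by (intro sum.cong) (auto simp: axis_components)
  moreover have "(\<Sum>k=1..<i. axis (u j) 1 $ v k) = (0::real)"
    using assms by (intro sum.neutral) (auto simp: axis_components)
  ultimately show ?thesis using assms by (simp add: cut_def sum.delta)
qed

lemma cut_axis_v:
  assumes "i \<in> {1..n}" "j \<in> {1..n}"
  shows "cut i (axis (v j) 1) = (if j < i then 1 else 0)"
proof -
  have "(\<Sum>k=1..<i. axis (v j) 1 $ v k) = (\<Sum>k=1..<i. if k = j then 1 else (0::real))"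
    using assms by (intro sum.cong) (auto simp: axis_components)
  moreover have "(\<Sum>k=1..i. axis (v j) 1 $ u k) = (0::real)"
    using assms by (intro sum.neutral) (auto simp: axis_components)
  ultimately show ?thesis using assms by (simp add: cut_def sum.delta)
qed

lemma total_axis: "total (axis w 1) = 1"
  by (simp add: total_def axis_def sum.delta')

lemma total_edge_vec: "total (edge_vec e) = 0"
  by (cases e) (simp add: edge_vec_def linear_diff[OF linear_total] total_axis)

text \<open>\<open>cut i\<close> sums over u_1, ..., u_i and v_1, ..., v_(i-1); only edges leaving
  this set contribute, namely two edges of block i and the long edge.\<close>

lemma cut_edge_vec:
  assumes "i \<in> {1..n}" "j \<in> {1..n}"
  shows "cut i (edge_vec (j, 0)) = (if j = i then 1 else 0)"
    "cut i (edge_vec (j, 1)) = 0"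
    "cut i (edge_vec (j, 2)) = (if j = i then 1 else 0)"
    "cut i (edge_vec (0, 3)) = 1"
  using assms by (auto simp: edge_vec_def linear_diff[OF linear_cut] cut_axis_u cut_axis_v)

lemma component_edge_vec:
  assumes "i \<in> {1..n}" "j \<in> {1..n}"
  shows "edge_vec (j, 0) $ v i = (if j = i then - 1 else 0)"
    "edge_vec (j, 1) $ v i = (if j = i then 1 else 0)"
    "edge_vec (j, 2) $ v i = 0"
    "edge_vec (0, 3) $ v i = 0"
  using assms by (auto simp: edge_vec_def axis_components)

lemma total_flow: "total (flow s a b c) = 0"
  by (simp add: flow_def linear_add[OF linear_total] linear_scale[OF linear_total]
      linear_sum[OF linear_total] total_edge_vec)

lemma cut_flow:
  assumes "i \<in> {1..n}"
  shows "cut i (flow s a b c) = s + a i + c i"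
proof -
  have "cut i (flow s a b c) = s + (\<Sum>j=1..n. if j = i then a i + c i else 0)"
    \<comment> \<open>The assumption n \<ge> 1 puts 1 into {1..n}; it instantiates the free index in
      the rule for the long edge.\<close>
    using assms n unfolding flow_def linear_add[OF linear_cut] linear_scale[OF linear_cut] linear_sum[OF linear_cut]
    by (intro arg_cong2[of _ _ _ _ "(+)"] sum.cong)
      (auto simp: cut_edge_vec cut_edge_vec(4)[of _ 1] simp del: One_nat_def)
  then show ?thesis using assms by (simp add: sum.delta)
qed

lemma component_flow:
  assumes "i \<in> {1..n}"
  shows "flow s a b c $ v i = b i - a i"
proof -
  have "flow s a b c $ v i = 0 + (\<Sum>j=1..n. if j = i then b i - a i else 0)"
    using assms n unfolding flow_def vector_add_component sum_component vector_scaleR_component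
    by (intro arg_cong2[of _ _ _ _ "(+)"] sum.cong)
      (auto simp: component_edge_vec component_edge_vec(4)[of _ 1] simp del: One_nat_def)
  then show ?thesis using assms by (simp add: sum.delta)
qed

text \<open>The cuts and the values at v give the partial sums over u, whose differences are the
  single values; the total then gives the value at u_(n+1).\<close>

lemma coordinates_determine:
  assumes "total x = total y"
    and "\<And>i. i \<in> {1..n} \<Longrightarrow> cut i x = cut i y"
    and "\<And>i. i \<in> {1..n} \<Longrightarrow> x $ v i = y $ v i"
  shows "x = y"
proof -
  have prefix: "(\<Sum>k=1..i. x $ u k) = (\<Sum>k=1..i. y $ u k)" if "i \<le> n" for i
  proof (cases "i = 0")
    case False
    have "(\<Sum>k=1..<i. x $ v k) = (\<Sum>k=1..<i. y $ v k)"
      using that assms(3) by (intro sum.cong) auto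
    then show ?thesis using assms(2)[of i] that False by (simp add: cut_def)
  qed simp
  have ui: "x $ u i = y $ u i" if "i \<in> {1..n}" for i
  proof -
    have "i = Suc (i - 1)" using that by simp
    then show ?thesis using prefix[of i] prefix[of "i - 1"] that
      by (metis (no_types, lifting) add_left_cancel atLeastAtMost_iff le_add2 less_imp_diff_less
          nat_less_le plus_1_eq_Suc sum.atLeast_Suc_atMost sum.cl_ivl_Suc linorder_not_le)
  qed
  have "(\<Sum>i=1..n. x $ v i) = (\<Sum>i=1..n. y $ v i)" using assms(3) by (intro sum.cong) auto
  then have "x $ u (n + 1) = y $ u (n + 1)"
    using assms(1) prefix[of n] unfolding total_def sum_vertices by simp
  then have "x $ w = y $ w" for w
  proof -
    have "w \<in> u ` {1..n+1} \<union> v ` {1..n}" using vertices by (simp add: Gamma_vertices_def)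
    then consider i where "i \<in> {1..n}" "w = u i" | "w = u (n + 1)" | i where "i \<in> {1..n}" "w = v i"
      by (auto simp: le_Suc_eq)
    then show ?thesis using ui assms(3) \<open>x $ u (n + 1) = y $ u (n + 1)\<close> by cases auto
  qed
  then show ?thesis by (simp add: vec_eq_iff)
qed

text \<open>The flow lives on a spanning tree: the path along the u_i, with v_i attached to
  u_(i+1).\<close>

lemma flow_of_coordinates:
  assumes "total x = 0"
  shows "flow 0 (\<lambda>_. 0) (\<lambda>i. x $ v i) (\<lambda>i. cut i x) = x"
  by (rule coordinates_determine) (simp_all add: total_flow assms cut_flow component_flow)

text \<open>Once the flow s on the long edge is fixed, the triangles can be optimized independently,
  block i having to carry \<open>cut i x - s\<close>.\<close>

lemma mem_dilate_iff:
  assumes "r \<ge> 0"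
  shows "x \<in> (\<lambda>y. r *\<^sub>R y) ` P \<longleftrightarrow>
    total x = 0 \<and> (\<exists>s. \<bar>s\<bar> + (\<Sum>i=1..n. rho (x $ v i) (cut i x - s)) \<le> r)"
  unfolding mem_dilate_iff_flow[OF assms]
proof
  assume "\<exists>s a b c. \<bar>s\<bar> + (\<Sum>i=1..n. \<bar>a i\<bar> + \<bar>b i\<bar> + \<bar>c i\<bar>) \<le> r \<and> x = flow s a b c"
  then obtain s a b c where r: "\<bar>s\<bar> + (\<Sum>i=1..n. \<bar>a i\<bar> + \<bar>b i\<bar> + \<bar>c i\<bar>) \<le> r" and x: "x = flow s a b c"
    by blast
  have "(\<Sum>i=1..n. rho (x $ v i) (cut i x - s)) \<le> (\<Sum>i=1..n. \<bar>a i\<bar> + \<bar>b i\<bar> + \<bar>c i\<bar>)"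
  proof (rule sum_mono)
    fix i assume "i \<in> {1..n}"
    then show "rho (x $ v i) (cut i x - s) \<le> \<bar>a i\<bar> + \<bar>b i\<bar> + \<bar>c i\<bar>"
      using rho_le_flow[of "x $ v i" "cut i x - s" "a i"] by (simp add: x component_flow cut_flow)
  qed
  then have "\<bar>s\<bar> + (\<Sum>i=1..n. rho (x $ v i) (cut i x - s)) \<le> r" using r by linarith
  then show "total x = 0 \<and> (\<exists>s. \<bar>s\<bar> + (\<Sum>i=1..n. rho (x $ v i) (cut i x - s)) \<le> r)"
    using total_flow x by blast
next
  assume "total x = 0 \<and> (\<exists>s. \<bar>s\<bar> + (\<Sum>i=1..n. rho (x $ v i) (cut i x - s)) \<le> r)"
  then obtain s where x: "total x = 0" and s: "\<bar>s\<bar> + (\<Sum>i=1..n. rho (x $ v i) (cut i x - s)) \<le> r"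
    by blast
  have "\<forall>i. \<exists>a. \<bar>a\<bar> + \<bar>x $ v i + a\<bar> + \<bar>cut i x - s - a\<bar> = rho (x $ v i) (cut i x - s)"
    using rho_attained by blast
  from choice[OF this] obtain a where
    a: "\<bar>a i\<bar> + \<bar>x $ v i + a i\<bar> + \<bar>cut i x - s - a i\<bar> = rho (x $ v i) (cut i x - s)" for i
    by blast
  \<comment> \<open>After the optimal a is chosen, the other two edge flows are forced by the value
    at v and by the cut.\<close>
  have "x = flow s a (\<lambda>i. x $ v i + a i) (\<lambda>i. cut i x - s - a i)"
    by (rule coordinates_determine) (simp_all add: total_flow x cut_flow component_flow)
  then show "\<exists>s a b c. \<bar>s\<bar> + (\<Sum>i=1..n. \<bar>a i\<bar> + \<bar>b i\<bar> + \<bar>c i\<bar>) \<le> r \<and> x = flow s a b c"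
    using s unfolding a[symmetric] by (intro exI conjI)
qed

text \<open>P contains 0, so its affine dimension is that of its span. By the spanning tree flows
  this span is the hyperplane of total zero in dimension 2n + 1.\<close>

lemma aff_dim_P: "aff_dim P = 2 * int n"
proof -
  have mem: "x \<in> P \<longleftrightarrow> (\<exists>s a b c. \<bar>s\<bar> + (\<Sum>i=1..n. \<bar>a i\<bar> + \<bar>b i\<bar> + \<bar>c i\<bar>) \<le> 1 \<and> x = flow s a b c)" for x
    using mem_dilate_iff_flow[of 1 x] by simp
  have "flow 0 (\<lambda>_. 0) (\<lambda>_. 0) (\<lambda>_. 0) \<in> P"
    unfolding mem by (intro exI conjI) (rule _, auto)
  then have zero: "0 \<in> P" by (simp add: flow_def)
  have edges: "edge_vec e \<in> P" if "e \<in> edge_idx" for e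
    unfolding P_eq_hull using that by (auto intro!: hull_inc)
  have "span P = {x. total x = 0}"
  proof
    have "P \<subseteq> {x. total x = 0}" using mem total_flow by auto
    moreover have "subspace {x. total x = 0}"
      by (rule linear_subspace_kernel[OF linear_total])
    ultimately show "span P \<subseteq> {x. total x = 0}" by (rule span_minimal)
    show "{x. total x = 0} \<subseteq> span P"
    proof
      fix x assume "x \<in> {x. total x = 0}"
      then have "x = flow 0 (\<lambda>_. 0) (\<lambda>i. x $ v i) (\<lambda>i. cut i x)" using flow_of_coordinates by simp
      also have "\<dots> \<in> span P"
        unfolding flow_def
        by (intro span_add span_sum span_scale span_base edges) (auto simp: edge_idx_def)
      finally show "x \<in> span P" .
    qed
  qed
  also have "{x. total x = 0} = {x. (\<chi> w. 1) \<bullet> x = 0}"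
    by (simp add: total_def inner_vec_def)
  finally have "dim P = dim {x :: real ^ 'v. (\<chi> w. 1) \<bullet> x = 0}"
    by (metis dim_span)
  moreover have "(\<chi> w. 1) \<noteq> (0 :: real ^ 'v)" by (simp add: vec_eq_iff)
  ultimately have "dim P = DIM(real ^ 'v) - 1" by (simp add: dim_hyperplane)
  then have "dim P = 2 * n" by (simp add: card_vertices)
  with aff_dim_zero[OF hull_inc[OF zero]] show ?thesis by simp
qed

text \<open>The floors merely convert to integers: on lattice points all these values are
  integral.\<close>

definition encode :: "real ^ 'v \<Rightarrow> (int \<times> int) list" where
  "encode x = map (\<lambda>i. (\<lfloor>x $ v i\<rfloor>, \<lfloor>cut i x\<rfloor>)) [1..<n + 1]"

lemma length_encode: "length (encode x) = n"
  by (simp add: encode_def)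

lemma Ints_cut: "(\<And>w. x $ w \<in> \<int>) \<Longrightarrow> cut i x \<in> \<int>" for x :: "real ^ 'v"
  unfolding cut_def by (intro Ints_add Ints_sum)

lemma flow_cost_encode:
  fixes x :: "real ^ 'v"
  assumes "\<And>w. x $ w \<in> \<int>"
  shows "flow_cost (real_pairs (encode x)) s = \<bar>s\<bar> + (\<Sum>i=1..n. rho (x $ v i) (cut i x - s))"
proof -
  have fl: "of_int \<lfloor>x $ w\<rfloor> = x $ w" "of_int \<lfloor>cut i x\<rfloor> = cut i x" for w i
    using assms Ints_cut[OF assms] by (metis Ints_cases floor_of_int)+
  have "(\<Sum>(b, y)\<leftarrow>real_pairs (encode x). rho b (y - s)) = (\<Sum>i\<leftarrow>[1..<n + 1]. rho (x $ v i) (cut i x - s))"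
    by (simp only: encode_def map_map comp_def case_prod_conv fl)
  also have "\<dots> = (\<Sum>i=1..n. rho (x $ v i) (cut i x - s))"
    by (simp only: interv_sum_list_conv_sum_set_nat) (intro sum.cong, auto)
  finally show ?thesis by (simp add: flow_cost_def)
qed

text \<open>\<open>encode\<close> is a bijection between the two sets, with spanning tree flows as
  its inverse; \<open>real_flow_cost_le_iff\<close> replaces the real circulation by an integral
  one.\<close>

lemma card_lattice_points:
  "card {x \<in> (\<lambda>y. real m *\<^sub>R y) ` P. \<forall>w. x $ w \<in> \<int>} =
   card {zs. length zs = n \<and> (\<exists>s. flow_cost zs s \<le> int m)}"
proof -
  let ?A = "{x \<in> (\<lambda>y. real m *\<^sub>R y) ` P. \<forall>w. x $ w \<in> \<int>}"
  have mem: "x \<in> ?A \<longleftrightarrow> (\<forall>w. x $ w \<in> \<int>) \<and> total x = 0 \<and> (\<exists>s. flow_cost (encode x) s \<le> int m)" for x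
  proof (cases "\<forall>w. x $ w \<in> \<int>")
    case True
    then have "flow_cost (real_pairs (encode x)) s = \<bar>s\<bar> + (\<Sum>i=1..n. rho (x $ v i) (cut i x - s))" for s
      by (intro flow_cost_encode) auto
    note fc = this[symmetric]
    show ?thesis
      using True unfolding mem_Collect_eq mem_dilate_iff[OF of_nat_0_le_iff] fc real_flow_cost_le_iff by blast
  qed auto
  have inj: "inj_on encode ?A"
  proof (rule inj_onI)
    fix x y assume x: "x \<in> ?A" and y: "y \<in> ?A" and eq: "encode x = encode y"
    have xi: "x $ w \<in> \<int>" "y $ w \<in> \<int>" for w using x y by auto
    have "\<lfloor>x $ v i\<rfloor> = \<lfloor>y $ v i\<rfloor> \<and> \<lfloor>cut i x\<rfloor> = \<lfloor>cut i y\<rfloor>" if "i \<in> {1..n}" for i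
      using eq that unfolding encode_def map_eq_conv by (auto simp del: upt_Suc)
    moreover have "x $ v i \<in> \<int>" "y $ v i \<in> \<int>" "cut i x \<in> \<int>" "cut i y \<in> \<int>" for i
      using xi Ints_cut by blast+
    ultimately show "x = y"
      using x y unfolding mem by (intro coordinates_determine) (auto, (metis Ints_cases floor_of_int)+)
  qed
  have image: "encode ` ?A = {zs. length zs = n \<and> (\<exists>s. flow_cost zs s \<le> int m)}"
  proof
    show "encode ` ?A \<subseteq> {zs. length zs = n \<and> (\<exists>s. flow_cost zs s \<le> int m)}"
    proof (rule image_subsetI)
      fix x assume "x \<in> ?A"
      then show "encode x \<in> {zs. length zs = n \<and> (\<exists>s. flow_cost zs s \<le> int m)}"
        unfolding mem using length_encode by blast
    qed
    show "{zs. length zs = n \<and> (\<exists>s. flow_cost zs s \<le> int m)} \<subseteq> encode ` ?A"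
    proof
      fix zs assume "zs \<in> {zs. length zs = n \<and> (\<exists>s. flow_cost zs s \<le> int m)}"
      then obtain s where zs: "length zs = n" and s: "flow_cost zs s \<le> int m" by blast
      \<comment> \<open>The spanning tree flow with prescribed coordinates; blocks are numbered from
        1 and list entries from 0.\<close>
      define x where "x = flow 0 (\<lambda>_. 0) (\<lambda>i. of_int (fst (zs ! (i - 1)))) (\<lambda>i. of_int (snd (zs ! (i - 1))))"
      have enc: "encode x = zs"
      proof (rule nth_equalityI)
        show "length (encode x) = length zs" by (rule trans[OF length_encode zs[symmetric]])
        fix i assume "i < length (encode x)"
        then have "i < n" by (simp only: length_encode)
        then show "encode x ! i = zs ! i"
          by (simp add: encode_def x_def cut_flow component_flow del: upt_Suc)
      qed
      have "edge_vec e $ w \<in> \<int>" for e w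
        by (cases e) (auto simp: edge_vec_def axis_def)
      then have "x $ w \<in> \<int>" for w
        unfolding x_def flow_def vector_add_component sum_component vector_scaleR_component real_scaleR_def
        by (intro Ints_add Ints_sum Ints_mult) auto
      moreover have "total x = 0" unfolding x_def by (rule total_flow)
      ultimately have "x \<in> ?A" unfolding mem enc using s by blast
      from imageI[OF this, of encode] show "zs \<in> encode ` ?A" unfolding enc .
    qed
  qed
  show ?thesis using card_image[OF inj] unfolding image by (rule sym)
qed

text \<open>The value 1 stipulated for m = 0 agrees with the count, as the dilate by 0 of a nonempty
  set is {0}.\<close>

lemma lattice_count_P:
  "lattice_count P m = card {zs. length zs = n \<and> (\<exists>s. flow_cost zs s \<le> int m)}"
proof (cases "m = 0")
  case True
  have "P \<noteq> {}" by (simp add: P_eq_hull edge_idx_def)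
  then have "(\<lambda>y. real m *\<^sub>R y) ` P = {0}"
    using True by (simp add: image_constant_conv)
  then have "{x \<in> (\<lambda>y. real m *\<^sub>R y) ` P. \<forall>w. x $ w \<in> \<int>} = {0}" by auto
  then have "card {x \<in> (\<lambda>y. real m *\<^sub>R y) ` P. \<forall>w. x $ w \<in> \<int>} = 1" by simp
  then show ?thesis using True unfolding card_lattice_points by (simp add: lattice_count_def)
next
  case False
  then show ?thesis using card_lattice_points[of m] by (simp add: lattice_count_def)
qed

end

theorem theorem4p3:
  fixes n :: nat and u v :: "nat \<Rightarrow> 'v::finite"
  assumes "n \<ge> 1" and "Gamma_vertices n u v"
  shows "hstar (sym_edge_polytope (Gamma_edges n u v)) =
    (\<Sum>l=0..n div 2. outer_factor n l *
       (\<Sum>(p, q)\<in>S_set (2*l). of_nat ((2*l + 1) choose (p + q + 1)) * f_poly p q l))"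
    (is "_ = ?rhs")
proof -
  interpret gamma n u v using assms by unfold_locales
  have dim: "nat (aff_dim P + 1) = 2 * n + 1" by (simp add: aff_dim_P nat_add_distrib nat_mult_distrib)
  have "hstar P = ?rhs"
  proof (rule hstar_eqI)
    \<comment> \<open>Both sides are compared after multiplication by 1 - T, which is then cancelled
      in the integral domain of power series.\<close>
    have "(1 - T) * fps_of_poly ?rhs = fps_of_poly (cyc_sum n)"
      unfolding rhs_eq_cyc_sum[symmetric]
      by (simp only: fps_of_poly_mult fps_of_poly_diff fps_of_poly_1 fps_of_poly_fps_X)
    also have "\<dots> = (1 - T) * (Abs_fps (\<lambda>m. int (lattice_count P m)) * (1 - T) ^ nat (aff_dim P + 1))"
      unfolding dim lattice_count_P card_reachable_eq_card_escaping by (rule escaping_configs_gf[symmetric])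
    finally have eq: "(1 - T) * fps_of_poly ?rhs = \<dots>" .
    have "1 - T \<noteq> 0"
    proof
      assume "1 - T = 0"
      then have "fps_nth (1 - T) 0 = 0" by simp
      then show False by simp
    qed
    then show "fps_of_poly ?rhs = Abs_fps (\<lambda>m. int (lattice_count P m)) * (1 - T) ^ nat (aff_dim P + 1)"
      using eq mult_left_cancel by blast
  qed
  then show ?thesis by (simp add: P_def)
qed

end
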